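(* Let $S$ be a $2$-separation of a matching covered graph $G$, and let $J$ be any $3$-connected cubic graph. Assume that if $J=\theta$ then $G-S$ has precisely two components. Then $G$ is $J$-free if and only if each marked $S$-component of $G$ is $J$-free.
   Context: Graphs are finite and loopless; multiple edges allowed; $\theta$ is two vertices joined by three parallel edges (considered $3$-connected cubic). A connected graph with at least two vertices is matching covered if every edge lies in a perfect matching. A barrier of a graph with a perfect matching is a set $B$ of vertices such that the number of odd components of $G-B$ equals $|B|$. A $2$-separation of a matching covered graph $G$ is a set $S$ of two vertices such that $G-S$ is disconnected and $S$ is not a barrier. For $S=\{u,v\}$ and a component $L$ of $G-S$, the marked $S$-component corresponding to $L$ is $G[V(L)\cup S]+uv$, where a new edge joining $u,v$ is added. A subgraph $H$ of $G$ is conformal if $G-V(H)$ has a perfect matching; a bisubdivision of $J$ is obtained by replacing some edges of $J$ by paths with an even number of internal vertices; a graph is $J$-based if it has a conformal subgraph that is a bisubdivision of $J$, and $J$-free otherwise. *)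

theory Defs
  imports Main
begin

section \<open>Finite loopless multigraphs\<close>

text \<open>Edges are named objects, so that parallel edges are distinct edges with the same set of ends.\<close>

record ('v, 'e) mgraph =
  verts :: "'v set"
  edges :: "'e set"
  ends  :: "'e \<Rightarrow> 'v set"

definition multigraph :: "('v, 'e) mgraph \<Rightarrow> bool" where
  "multigraph G \<longleftrightarrow> finite (verts G) \<and> finite (edges G) \<and>
     (\<forall>e\<in>edges G. ends G e \<subseteq> verts G \<and> card (ends G e) = 2)"

definition subgraph :: "('v, 'e) mgraph \<Rightarrow> ('v, 'e) mgraph \<Rightarrow> bool" where
  "subgraph H G \<longleftrightarrow> multigraph H \<and> verts H \<subseteq> verts G \<and> edges H \<subseteq> edges G \<and>
     (\<forall>e\<in>edges H. ends H e = ends G e)"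

definition induced :: "('v, 'e) mgraph \<Rightarrow> 'v set \<Rightarrow> ('v, 'e) mgraph" where
  "induced G X = \<lparr>verts = X, edges = {e \<in> edges G. ends G e \<subseteq> X}, ends = ends G\<rparr>"

definition del_verts :: "('v, 'e) mgraph \<Rightarrow> 'v set \<Rightarrow> ('v, 'e) mgraph" where
  "del_verts G X = induced G (verts G - X)"

section \<open>Connectivity\<close>

definition adj :: "('v, 'e) mgraph \<Rightarrow> ('v \<times> 'v) set" where
  "adj G = {(u, v). \<exists>e\<in>edges G. ends G e = {u, v}}"

text \<open>The null graph counts as connected, so a graph that is not connected has at least two
  components.\<close>

definition connected_graph :: "('v, 'e) mgraph \<Rightarrow> bool" where
  "connected_graph G \<longleftrightarrow> (\<forall>u\<in>verts G. \<forall>v\<in>verts G. (u, v) \<in> (adj G)\<^sup>*)"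

text \<open>A component is represented by its vertex set.\<close>

definition components :: "('v, 'e) mgraph \<Rightarrow> 'v set set" where
  "components G = {{v \<in> verts G. (u, v) \<in> (adj G)\<^sup>*} | u. u \<in> verts G}"

definition k_connected :: "nat \<Rightarrow> ('v, 'e) mgraph \<Rightarrow> bool" where
  "k_connected k G \<longleftrightarrow> k < card (verts G) \<and>
     (\<forall>X. X \<subseteq> verts G \<and> card X < k \<longrightarrow> connected_graph (del_verts G X))"

definition cubic :: "('v, 'e) mgraph \<Rightarrow> bool" where
  "cubic G \<longleftrightarrow> (\<forall>v\<in>verts G. card {e \<in> edges G. v \<in> ends G e} = 3)"

definition is_theta :: "('v, 'e) mgraph \<Rightarrow> bool" where
  "is_theta G \<longleftrightarrow> card (verts G) = 2 \<and> card (edges G) = 3 \<and> (\<forall>e\<in>edges G. ends G e = verts G)"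

text \<open>The graph \<open>\<theta>\<close> has too few vertices for \<open>k_connected 3\<close>; by convention it is included.\<close>

definition three_connected_cubic :: "('v, 'e) mgraph \<Rightarrow> bool" where
  "three_connected_cubic G \<longleftrightarrow> multigraph G \<and> cubic G \<and> (k_connected 3 G \<or> is_theta G)"

section \<open>Perfect matchings, barriers and 2-separations\<close>

definition perfect_matching :: "('v, 'e) mgraph \<Rightarrow> 'e set \<Rightarrow> bool" where
  "perfect_matching G M \<longleftrightarrow> M \<subseteq> edges G \<and> (\<forall>v\<in>verts G. \<exists>!e. e \<in> M \<and> v \<in> ends G e)"

definition matching_covered :: "('v, 'e) mgraph \<Rightarrow> bool" where
  "matching_covered G \<longleftrightarrow> multigraph G \<and> connected_graph G \<and> 2 \<le> card (verts G) \<and>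
     (\<forall>e\<in>edges G. \<exists>M. perfect_matching G M \<and> e \<in> M)"

definition barrier :: "('v, 'e) mgraph \<Rightarrow> 'v set \<Rightarrow> bool" where
  "barrier G B \<longleftrightarrow> (\<exists>M. perfect_matching G M) \<and> B \<subseteq> verts G \<and>
     card {C \<in> components (del_verts G B). odd (card C)} = card B"

definition two_separation :: "('v, 'e) mgraph \<Rightarrow> 'v set \<Rightarrow> bool" where
  "two_separation G S \<longleftrightarrow> S \<subseteq> verts G \<and> card S = 2 \<and>
     \<not> connected_graph (del_verts G S) \<and> \<not> barrier G S"

text \<open>\<open>None\<close> is the new edge; it is added even if the two vertices of \<open>S\<close> are already adjacent.\<close>

definition marked_component ::
  "('v, 'e) mgraph \<Rightarrow> 'v set \<Rightarrow> 'v set \<Rightarrow> ('v, 'e option) mgraph" where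
  "marked_component G S L =
     \<lparr>verts = L \<union> S,
      edges = insert None (Some ` edges (induced G (L \<union> S))),
      ends = case_option S (ends G)\<rparr>"

section \<open>Conformal subgraphs and bisubdivisions\<close>

definition conformal :: "('v, 'e) mgraph \<Rightarrow> ('v, 'e) mgraph \<Rightarrow> bool" where
  "conformal H G \<longleftrightarrow> subgraph H G \<and> (\<exists>M. perfect_matching (del_verts G (verts H)) M)"

text \<open>Paths carry their edge list, since parallel edges make the vertex list ambiguous.\<close>

definition is_path :: "('v, 'e) mgraph \<Rightarrow> 'v list \<Rightarrow> 'e list \<Rightarrow> bool" where
  "is_path G xs es \<longleftrightarrow> length xs = Suc (length es) \<and> distinct xs \<and>
     set xs \<subseteq> verts G \<and> set es \<subseteq> edges G \<and>
     (\<forall>i<length es. ends G (es ! i) = {xs ! i, xs ! Suc i})"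

definition internal :: "'v list \<Rightarrow> 'v list" where
  "internal xs = butlast (tl xs)"

text \<open>The vertex \<open>x\<close> of \<open>J\<close> becomes \<open>f x\<close> and the edge \<open>e\<close> of \<open>J\<close> becomes the path with vertex list
  \<open>p e\<close> and edge list \<open>q e\<close>; an edge that is not replaced has no internal vertices. The condition
  on the edge sets is needed because two parallel edges of \<open>J\<close> must not become the same edge.\<close>

definition bisubdivision :: "('v, 'e) mgraph \<Rightarrow> ('w, 'f) mgraph \<Rightarrow> bool" where
  "bisubdivision H J \<longleftrightarrow> (\<exists>f p q.
     inj_on f (verts J) \<and>
     (\<forall>e\<in>edges J. is_path H (p e) (q e) \<and>
        {hd (p e), last (p e)} = f ` ends J e \<and>
        even (length (internal (p e))) \<and>
        set (internal (p e)) \<inter> f ` verts J = {}) \<and>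
     (\<forall>e\<in>edges J. \<forall>e'\<in>edges J. e \<noteq> e' \<longrightarrow>
        set (internal (p e)) \<inter> set (internal (p e')) = {} \<and> set (q e) \<inter> set (q e') = {}) \<and>
     verts H = f ` verts J \<union> (\<Union>e\<in>edges J. set (internal (p e))) \<and>
     edges H = (\<Union>e\<in>edges J. set (q e)))"

definition based :: "('w, 'f) mgraph \<Rightarrow> ('v, 'e) mgraph \<Rightarrow> bool" where
  "based J G \<longleftrightarrow> (\<exists>H. conformal H G \<and> bisubdivision H J)"

definition free_of :: "('w, 'f) mgraph \<Rightarrow> ('v, 'e) mgraph \<Rightarrow> bool" where
  "free_of J G \<longleftrightarrow> \<not> based J G"

end

theory Submission
  imports Defs
begin

text \<open>All components of \<open>G - S\<close> are even because \<open>S\<close> is not a barrier, so every perfect matching sends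
  both or neither of the vertices of \<open>S\<close> into a given component. Hence on the far side of a
  component one has a perfect matching with \<open>S\<close> and one without \<open>S\<close>; their alternating path joins
  the vertices of \<open>S\<close>, has evenly many internal vertices and can replace the marker edge in a
  bisubdivision of \<open>J\<close>. Conversely, two vertices of \<open>G\<close> hit at most two vertices or edges
  of \<open>J\<close>, and these cannot separate \<open>J\<close>. So the branch vertices of a bisubdivision of \<open>J\<close> lie
  in one component together with \<open>S\<close>, and unless \<open>S\<close> consists of the two branch vertices of \<open>\<theta>\<close>
  at most one path leaves that side. The excursion runs between the two vertices of \<open>S\<close>, is even by
  the matching of the rest, and is contracted to the marker edge. For \<open>\<theta>\<close> with branch set \<open>S\<close> and
  two components, one of the two sides contains at most one of the three paths.\<close>

section \<open>Matchings covering a vertex set\<close>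

text \<open>A perfect matching of the subgraph of \<open>K\<close> induced by \<open>X\<close>,
  stated without forming that subgraph, so that matchings of different vertex sets of one graph can
  be united, cut down and compared.\<close>

definition matching_on :: "('v, 'e) mgraph \<Rightarrow> 'v set \<Rightarrow> 'e set \<Rightarrow> bool" where
  "matching_on K X M \<longleftrightarrow> M \<subseteq> edges K \<and> (\<forall>e\<in>M. ends K e \<subseteq> X) \<and>
     (\<forall>v\<in>X. \<exists>e\<in>M. v \<in> ends K e) \<and>
     (\<forall>e\<in>M. \<forall>e'\<in>M. ends K e \<inter> ends K e' \<noteq> {} \<longrightarrow> e = e')"

lemma perfect_matching_induced:
  "perfect_matching (induced K X) M \<longleftrightarrow> matching_on K X M"
proof
  assume "perfect_matching (induced K X) M"
  then show "matching_on K X M"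
    unfolding perfect_matching_def induced_def matching_on_def by (auto; blast)
next
  assume "matching_on K X M"
  then show "perfect_matching (induced K X) M"
    unfolding perfect_matching_def induced_def matching_on_def by (auto; blast)
qed

lemma perfect_matching_iff_matching_on:
  assumes "multigraph K"
  shows "perfect_matching K M \<longleftrightarrow> matching_on K (verts K) M"
proof -
  have "perfect_matching K M \<longleftrightarrow> perfect_matching (induced K (verts K)) M"
    using assms unfolding perfect_matching_def induced_def multigraph_def by auto
  then show ?thesis by (simp add: perfect_matching_induced)
qed

lemma matching_on_unique:
  "matching_on K X M \<Longrightarrow> e \<in> M \<Longrightarrow> e' \<in> M \<Longrightarrow> v \<in> ends K e \<Longrightarrow> v \<in> ends K e' \<Longrightarrow> e = e'"
  unfolding matching_on_def by blast

lemma matching_on_even: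
  assumes "multigraph K" "matching_on K X M"
  shows "even (card X)"
proof -
  have fin: "finite M"
    using assms finite_subset unfolding multigraph_def matching_on_def by blast
  have card2: "card (ends K e) = 2" if "e \<in> M" for e
    using assms that unfolding multigraph_def matching_on_def by blast
  have "X = (\<Union>e\<in>M. ends K e)"
    using assms unfolding matching_on_def by blast
  then have "card X = card (\<Union>e\<in>M. ends K e)" by simp
  also have "\<dots> = (\<Sum>e\<in>M. card (ends K e))"
  proof (rule card_UN_disjoint[OF fin])
    show "\<forall>i\<in>M. finite (ends K i)"
      using card2 by (metis card.infinite zero_neq_numeral)
    show "\<forall>i\<in>M. \<forall>j\<in>M. i \<noteq> j \<longrightarrow> ends K i \<inter> ends K j = {}"
      using assms(2) unfolding matching_on_def by blast
  qed
  also have "\<dots> = 2 * card M"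
    using card2 by simp
  finally show ?thesis by simp
qed

text \<open>The last hypothesis says that no matching edge leaves \<open>Y\<close>, so each vertex
  of \<open>Y\<close> keeps its partner.\<close>

lemma matching_on_restrict:
  assumes "matching_on K X M" "Y \<subseteq> X" "\<And>e. e \<in> M \<Longrightarrow> ends K e \<inter> Y \<noteq> {} \<Longrightarrow> ends K e \<subseteq> Y"
  shows "matching_on K Y {e \<in> M. ends K e \<subseteq> Y}"
proof -
  have "\<exists>e\<in>{e \<in> M. ends K e \<subseteq> Y}. v \<in> ends K e" if v: "v \<in> Y" for v
  proof -
    obtain e where "e \<in> M" "v \<in> ends K e"
      using assms(1,2) v unfolding matching_on_def by blast
    then show ?thesis using assms(3)[of e] v by blast
  qed
  then show ?thesis using assms(1) unfolding matching_on_def by auto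
qed

lemma matching_onI:
  assumes "M \<subseteq> edges K" "\<And>e. e \<in> M \<Longrightarrow> ends K e \<subseteq> X" "\<And>v. v \<in> X \<Longrightarrow> \<exists>e\<in>M. v \<in> ends K e"
    "\<And>e e' v. e \<in> M \<Longrightarrow> e' \<in> M \<Longrightarrow> v \<in> ends K e \<Longrightarrow> v \<in> ends K e' \<Longrightarrow> e = e'"
  shows "matching_on K X M"
  unfolding matching_on_def using assms by (intro conjI ballI impI) (blast+)

lemma matching_onD:
  assumes "matching_on K X M"
  shows "M \<subseteq> edges K" "\<And>e. e \<in> M \<Longrightarrow> ends K e \<subseteq> X" "\<And>v. v \<in> X \<Longrightarrow> \<exists>e\<in>M. v \<in> ends K e"
  using assms unfolding matching_on_def by auto

lemma matching_on_Un:
  assumes M: "matching_on K X M" and N: "matching_on K Y N" and disj: "X \<inter> Y = {}"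
  shows "matching_on K (X \<union> Y) (M \<union> N)"
proof (rule matching_onI)
  fix e e' v
  assume *: "e \<in> M \<union> N" "e' \<in> M \<union> N" "v \<in> ends K e" "v \<in> ends K e'"
  have "e \<in> M \<Longrightarrow> v \<in> X" "e' \<in> M \<Longrightarrow> v \<in> X" "e \<in> N \<Longrightarrow> v \<in> Y" "e' \<in> N \<Longrightarrow> v \<in> Y"
    using * matching_onD(2)[OF M] matching_onD(2)[OF N] by auto
  then show "e = e'"
    using * disj matching_on_unique[OF M] matching_on_unique[OF N] by auto
next
  fix v assume "v \<in> X \<union> Y"
  then show "\<exists>e\<in>M \<union> N. v \<in> ends K e"
    using matching_onD(3)[OF M, of v] matching_onD(3)[OF N, of v] by blast
next
  fix e assume "e \<in> M \<union> N"
  then show "ends K e \<subseteq> X \<union> Y"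
    using matching_onD(2)[OF M, of e] matching_onD(2)[OF N, of e] by blast
qed (use matching_onD(1)[OF M] matching_onD(1)[OF N] in auto)

lemma matching_on_remove_edge:
  assumes M: "matching_on K X M" and "e \<in> M"
  shows "matching_on K (X - ends K e) (M - {e})"
proof (rule matching_onI)
  fix v assume "v \<in> X - ends K e"
  then show "\<exists>e'\<in>M - {e}. v \<in> ends K e'"
    using matching_onD(3)[OF M, of v] by blast
next
  fix e' assume "e' \<in> M - {e}"
  then show "ends K e' \<subseteq> X - ends K e"
    using matching_onD(2)[OF M] matching_on_unique[OF M] \<open>e \<in> M\<close> by blast
qed (use matching_onD[OF M] matching_on_unique[OF M] in auto)

lemma matching_on_edge:
  assumes "e \<in> edges K"
  shows "matching_on K (ends K e) {e}"
  using assms unfolding matching_on_def by auto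

lemma matching_on_partner:
  assumes "multigraph K" "matching_on K X M" "u \<in> X"
  obtains e w where "e \<in> M" "ends K e = {u, w}" "w \<noteq> u" "w \<in> X"
proof -
  obtain e where e: "e \<in> M" "u \<in> ends K e"
    using assms(2,3) unfolding matching_on_def by blast
  then have "card (ends K e) = 2"
    using assms(1,2) unfolding matching_on_def multigraph_def by blast
  then obtain x y where "ends K e = {x, y}" "x \<noteq> y"
    by (auto simp: card_2_iff)
  then obtain w where "ends K e = {u, w}" "w \<noteq> u"
    using e(2) by (cases "u = x") (auto simp: insert_commute)
  then show ?thesis using that[OF e(1)] matching_onD(2)[OF assms(2) e(1)] by blast
qed

section \<open>Paths\<close>

lemma is_path_Cons:
  "is_path K (x # ys) (e # es) \<longleftrightarrow> ys \<noteq> [] \<and> e \<in> edges K \<and> ends K e = {x, hd ys} \<and>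
     x \<in> verts K \<and> x \<notin> set ys \<and> is_path K ys es"
proof (cases ys)
  case (Cons y xs)
  have "is_path K (x # y # xs) (e # es) \<longleftrightarrow> e \<in> edges K \<and> ends K e = {x, y} \<and> x \<in> verts K \<and>
     x \<notin> set (y # xs) \<and> is_path K (y # xs) es"
    unfolding is_path_def by (auto simp: All_less_Suc2)
  then show ?thesis using Cons by simp
qed (simp add: is_path_def)

lemma is_path_single: "is_path K [x] es \<longleftrightarrow> es = [] \<and> x \<in> verts K"
  unfolding is_path_def by auto

lemma is_path_append:
  assumes "is_path K (xs @ a # ys) es"
  shows "\<exists>es1 es2. es = es1 @ es2 \<and> is_path K (xs @ [a]) es1 \<and> is_path K (a # ys) es2"
  using assms
proof (induction xs arbitrary: es)
  case Nil
  then show ?case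
    by (intro exI[of _ "[]"] exI[of _ es]) (auto simp: is_path_def)
next
  case (Cons x xs)
  obtain e es' where e: "es = e # es'"
    using Cons.prems by (cases es) (auto simp: is_path_def)
  have st: "e \<in> edges K" "ends K e = {x, hd (xs @ [a])}" "x \<in> verts K"
    "x \<notin> set (xs @ [a])" "is_path K (xs @ a # ys) es'"
    using Cons.prems by (simp_all add: e is_path_Cons hd_append split: if_splits)
  from Cons.IH[OF st(5)] obtain es1 es2
    where "es' = es1 @ es2" "is_path K (xs @ [a]) es1" "is_path K (a # ys) es2"
    by blast
  then have "es = (e # es1) @ es2" "is_path K ((x # xs) @ [a]) (e # es1)"
    using st e by (simp_all add: is_path_Cons)
  then show ?case using \<open>is_path K (a # ys) es2\<close> by blast
qed

lemma is_path_join: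
  assumes "is_path K (xs @ [a]) es1" "is_path K (a # ys) es2" "set xs \<inter> set ys = {}"
  shows "is_path K (xs @ a # ys) (es1 @ es2)"
  using assms
proof (induction xs arbitrary: es1)
  case Nil
  then show ?case by (auto simp: is_path_single)
next
  case (Cons x xs)
  obtain e es' where e: "es1 = e # es'"
    using Cons.prems(1) by (cases es1) (auto simp: is_path_def)
  show ?case
    using Cons by (auto simp: e is_path_Cons hd_append)
qed

lemma is_path_edge_split:
  assumes "is_path K xs es" "z \<in> set es"
  obtains xs1 a b xs2 es1 es2 where "xs = xs1 @ a # b # xs2" "es = es1 @ z # es2"
    "is_path K (xs1 @ [a]) es1" "is_path K (b # xs2) es2" "ends K z = {a, b}"
  using assms
proof (induction xs arbitrary: es thesis)
  case Nil
  then show ?case by (auto simp: is_path_def)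
next
  case (Cons x xs)
  obtain e es' where e: "es = e # es'" using Cons.prems(3) by (cases es) auto
  have st: "xs \<noteq> []" "e \<in> edges K" "ends K e = {x, hd xs}" "x \<in> verts K" "x \<notin> set xs"
    "is_path K xs es'"
    using Cons.prems(2) by (auto simp: e is_path_Cons)
  show ?case
  proof (cases "z = e")
    case True
    then show ?thesis
      using Cons.prems(1)[of "[]" x "hd xs" "tl xs" "[]" es'] st e by (auto simp: is_path_single)
  next
    case False
    then have "z \<in> set es'" using Cons.prems(3) e by auto
    then obtain xs1 a b xs2 es1 es2 where s: "xs = xs1 @ a # b # xs2" "es' = es1 @ z # es2"
      "is_path K (xs1 @ [a]) es1" "is_path K (b # xs2) es2" "ends K z = {a, b}"
      using Cons.IH[OF _ st(6)] by blast
    then have "is_path K ((x # xs1) @ [a]) (e # es1)"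
      using st by (auto simp: is_path_Cons hd_append)
    then show ?thesis
      using Cons.prems(1)[of "x # xs1" a b xs2 "e # es1" es2] s e by auto
  qed
qed

lemma is_path_edge_ends:
  assumes "is_path K xs es" "e \<in> set es"
  shows "ends K e \<subseteq> set xs"
proof -
  obtain xs1 a b xs2 where "xs = xs1 @ a # b # xs2" "ends K e = {a, b}"
    using is_path_edge_split[OF assms] by metis
  then show ?thesis by auto
qed

lemma internal_split: "internal (a # ms @ [b]) = ms"
  unfolding internal_def by (simp add: butlast_append)

lemma path_split_ends:
  assumes "xs \<noteq> []" "hd xs \<noteq> last xs"
  shows "xs = hd xs # internal xs @ [last xs]"
proof -
  obtain x ys where xs: "xs = x # ys" using assms(1) by (cases xs) auto
  then obtain zs y where "ys = zs @ [y]" using assms(2) by (cases ys rule: rev_cases) auto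
  with xs show ?thesis by (simp add: internal_split)
qed

lemma set_internal:
  assumes "distinct xs" "xs \<noteq> []" "hd xs \<noteq> last xs"
  shows "set (internal xs) = set xs - {hd xs, last xs}"
proof -
  obtain x ms y where "xs = x # ms @ [y]" using path_split_ends[OF assms(2,3)] by blast
  then show ?thesis using assms(1) by (auto simp: internal_split)
qed

lemma length_internal:
  assumes "xs \<noteq> []" "hd xs \<noteq> last xs"
  shows "length xs = length (internal xs) + 2"
  using arg_cong[OF path_split_ends[OF assms], of length] by simp

lemma alternating_path:
  assumes "multigraph K" "finite X" "matching_on K (insert u (insert v X)) M1"
    "matching_on K X M2" "insert u (insert v X) \<subseteq> verts K" "u \<noteq> v" "u \<notin> X" "v \<notin> X"
  shows "\<exists>xs es N. is_path K (u # xs @ [v]) es \<and> set xs \<subseteq> X \<and> even (length xs) \<and>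
    set es \<subseteq> M1 \<union> M2 \<and> matching_on K (X - set xs) N \<and> N \<subseteq> M2"
  using assms(2-)
proof (induction X arbitrary: u M1 M2 rule: finite_psubset_induct)
  case (psubset X)
  note M1 = psubset.prems(1) and M2 = psubset.prems(2)
  obtain e x where e: "e \<in> M1" "ends K e = {u, x}" "x \<noteq> u" "x \<in> insert u (insert v X)"
    using matching_on_partner[OF assms(1) M1, of u] by blast
  have eK: "e \<in> edges K" using e(1) M1 unfolding matching_on_def by blast
  show ?case
  proof (cases "x = v")
    case True
    have "is_path K (u # [] @ [v]) [e]"
      using e eK True psubset.prems by (auto simp: is_path_Cons is_path_single)
    then show ?thesis using e(1) M2
      by (intro exI[of _ "[]"] exI[of _ "[e]"] exI[of _ M2]) auto
  next
    case False
    then have x: "x \<in> X" using e by auto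
    obtain d y where d: "d \<in> M2" "ends K d = {x, y}" "y \<noteq> x" "y \<in> X"
      using matching_on_partner[OF assms(1) M2 x] by blast
    have dK: "d \<in> edges K" using d(1) M2 unfolding matching_on_def by blast
    define X' where "X' = X - {x, y}"
    \<comment> \<open>The vertex \<open>y\<close> takes over the role of \<open>u\<close>: the rest
      of \<open>M1\<close> covers \<open>y\<close>, \<open>v\<close> and \<open>X'\<close>, the rest
      of \<open>M2\<close> covers \<open>X'\<close> only.\<close>
    have "insert u (insert v X) - ends K e = insert y (insert v X')"
      using e d x psubset.prems False unfolding X'_def by auto
    then have m1: "matching_on K (insert y (insert v X')) (M1 - {e})"
      using matching_on_remove_edge[OF M1 e(1)] by simp
    have m2: "matching_on K X' (M2 - {d})"
      using matching_on_remove_edge[OF M2 d(1)] d(2) by (simp add: X'_def)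
    have "X' \<subset> X" "insert y (insert v X') \<subseteq> verts K" "y \<noteq> v" "y \<notin> X'" "v \<notin> X'"
      using x d psubset.prems by (auto simp: X'_def)
    from psubset.IH[OF this(1) m1 m2 this(2-)] obtain xs es N where
      ih: "is_path K (y # xs @ [v]) es" "set xs \<subseteq> X'" "even (length xs)"
        "set es \<subseteq> (M1 - {e}) \<union> (M2 - {d})" "matching_on K (X' - set xs) N" "N \<subseteq> M2 - {d}"
      by blast
    have "is_path K (u # (x # y # xs) @ [v]) (e # d # es)"
      using ih e d eK dK x psubset.prems False by (auto simp: is_path_Cons X'_def)
    moreover have "X - set (x # y # xs) = X' - set xs" by (auto simp: X'_def)
    ultimately show ?thesis
      using ih x d e
      by (intro exI[of _ "x # y # xs"] exI[of _ "e # d # es"] exI[of _ N]) (auto simp: X'_def)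
  qed
qed

section \<open>Embedded bisubdivisions\<close>

text \<open>The data of a bisubdivision placed directly in an ambient graph \<open>K\<close>,
  without naming the subgraph. Embeddings in \<open>G\<close> and in its marked components can then
  be compared inside one graph, and a single path can be exchanged.\<close>

definition embedding ::
  "('v, 'e) mgraph \<Rightarrow> ('w, 'f) mgraph \<Rightarrow> ('w \<Rightarrow> 'v) \<Rightarrow> ('f \<Rightarrow> 'v list) \<Rightarrow> ('f \<Rightarrow> 'e list) \<Rightarrow> bool"
where
  "embedding K J f p q \<longleftrightarrow> inj_on f (verts J) \<and> f ` verts J \<subseteq> verts K \<and>
     (\<forall>e\<in>edges J. is_path K (p e) (q e) \<and>
        {hd (p e), last (p e)} = f ` ends J e \<and>
        even (length (internal (p e))) \<and>
        set (internal (p e)) \<inter> f ` verts J = {}) \<and>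
     (\<forall>e\<in>edges J. \<forall>e'\<in>edges J. e \<noteq> e' \<longrightarrow>
        set (internal (p e)) \<inter> set (internal (p e')) = {} \<and> set (q e) \<inter> set (q e') = {})"

text \<open>The vertex set of the embedded bisubdivision; conformality asks for a matching of its
  complement.\<close>

definition support :: "('w, 'f) mgraph \<Rightarrow> ('w \<Rightarrow> 'v) \<Rightarrow> ('f \<Rightarrow> 'v list) \<Rightarrow> 'v set" where
  "support J f p = f ` verts J \<union> (\<Union>e\<in>edges J. set (internal (p e)))"

lemma embeddingD:
  assumes "embedding K J f p q"
  shows "inj_on f (verts J)" "f ` verts J \<subseteq> verts K"
    "\<And>e. e \<in> edges J \<Longrightarrow> is_path K (p e) (q e)"
    "\<And>e. e \<in> edges J \<Longrightarrow> {hd (p e), last (p e)} = f ` ends J e"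
    "\<And>e. e \<in> edges J \<Longrightarrow> even (length (internal (p e)))"
    "\<And>e. e \<in> edges J \<Longrightarrow> set (internal (p e)) \<inter> f ` verts J = {}"
    "\<And>e e'. e \<in> edges J \<Longrightarrow> e' \<in> edges J \<Longrightarrow> e \<noteq> e' \<Longrightarrow>
        set (internal (p e)) \<inter> set (internal (p e')) = {}"
    "\<And>e e'. e \<in> edges J \<Longrightarrow> e' \<in> edges J \<Longrightarrow> e \<noteq> e' \<Longrightarrow> set (q e) \<inter> set (q e') = {}"
  using assms by (simp_all add: embedding_def)

lemma is_pathD:
  assumes "is_path K xs es"
  shows "xs \<noteq> []" "distinct xs" "set xs \<subseteq> verts K" "set es \<subseteq> edges K" "length xs = Suc (length es)"
  using assms unfolding is_path_def by auto

lemma is_path_transfer: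
  assumes "is_path K xs es" "set xs \<subseteq> verts K'" "g ` set es \<subseteq> edges K'"
    "\<And>e. e \<in> set es \<Longrightarrow> ends K' (g e) = ends K e"
  shows "is_path K' xs (map g es)"
  using assms unfolding is_path_def by auto

lemma is_path_mono:
  assumes "is_path K xs es" "set xs \<subseteq> verts K'" "set es \<subseteq> edges K'"
    "\<And>e. e \<in> set es \<Longrightarrow> ends K' e = ends K e"
  shows "is_path K' xs es"
  using is_path_transfer[OF assms(1,2), of id] assms(3,4) by simp

text \<open>As \<open>J\<close> is loopless and \<open>f\<close> is injective on its vertices, the
  two ends of a path differ; hence \<open>internal\<close> removes exactly these two
  vertices.\<close>

lemma embedding_path_ends:
  assumes "multigraph J" "embedding K J f p q" "e \<in> edges J"
  shows "hd (p e) \<noteq> last (p e)" "p e \<noteq> []" "distinct (p e)"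
    "hd (p e) \<in> f ` verts J" "last (p e) \<in> f ` verts J"
    "set (internal (p e)) = set (p e) - {hd (p e), last (p e)}"
    "set (p e) = {hd (p e), last (p e)} \<union> set (internal (p e))"
proof -
  have sub: "ends J e \<subseteq> verts J" and c: "card (ends J e) = 2"
    using assms(1,3) unfolding multigraph_def by auto
  have "inj_on f (ends J e)"
    using embeddingD(1)[OF assms(2)] sub by (rule inj_on_subset)
  then have "card {hd (p e), last (p e)} = 2"
    using c by (simp add: embeddingD(4)[OF assms(2,3)] card_image)
  then show ne: "hd (p e) \<noteq> last (p e)" by auto
  show p: "p e \<noteq> []" "distinct (p e)"
    using is_pathD(1,2)[OF embeddingD(3)[OF assms(2,3)]] by auto
  show "hd (p e) \<in> f ` verts J" "last (p e) \<in> f ` verts J"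
    using embeddingD(4)[OF assms(2,3)] sub by blast+
  show i: "set (internal (p e)) = set (p e) - {hd (p e), last (p e)}"
    by (rule set_internal[OF p(2,1) ne])
  show "set (p e) = {hd (p e), last (p e)} \<union> set (internal (p e))"
    unfolding i using p(1) by auto
qed

lemma set_path_subset_support:
  assumes "multigraph J" "embedding K J f p q" "e \<in> edges J"
  shows "set (p e) \<subseteq> support J f p"
  unfolding embedding_path_ends(7)[OF assms] support_def
  using embedding_path_ends(4,5)[OF assms] assms(3) by blast

lemma support_subset_verts:
  assumes "multigraph J" "embedding K J f p q"
  shows "support J f p \<subseteq> verts K"
proof -
  have "set (internal (p e)) \<subseteq> verts K" if "e \<in> edges J" for e
    using embedding_path_ends(6)[OF assms that] is_pathD(3)[OF embeddingD(3)[OF assms(2) that]]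
    by blast
  then show ?thesis using embeddingD(2)[OF assms(2)] unfolding support_def by auto
qed

lemma based_iff_embedding:
  assumes K: "multigraph K" and J: "multigraph J"
  shows "based J K \<longleftrightarrow>
    (\<exists>f p q N. embedding K J f p q \<and> matching_on K (verts K - support J f p) N)"
proof
  assume "based J K"
  then obtain H N where H: "subgraph H K" and b: "bisubdivision H J"
    and N: "matching_on K (verts K - verts H) N"
    unfolding based_def conformal_def del_verts_def perfect_matching_induced by blast
  obtain f p q where
    f: "inj_on f (verts J)" and
    paths: "\<forall>e\<in>edges J. is_path H (p e) (q e) \<and>
        {hd (p e), last (p e)} = f ` ends J e \<and>
        even (length (internal (p e))) \<and>
        set (internal (p e)) \<inter> f ` verts J = {}" and
    disj: "\<forall>e\<in>edges J. \<forall>e'\<in>edges J. e \<noteq> e' \<longrightarrow>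
        set (internal (p e)) \<inter> set (internal (p e')) = {} \<and> set (q e) \<inter> set (q e') = {}" and
    vH: "verts H = f ` verts J \<union> (\<Union>e\<in>edges J. set (internal (p e)))"
    using b unfolding bisubdivision_def by (elim exE conjE)
  have "is_path K (p e) (q e)" if "is_path H (p e) (q e)" for e
  proof (rule is_path_mono[OF that])
    show "set (p e) \<subseteq> verts K" "set (q e) \<subseteq> edges K"
      "\<And>d. d \<in> set (q e) \<Longrightarrow> ends K d = ends H d"
      using is_pathD(3,4)[OF that] H unfolding subgraph_def by auto
  qed
  moreover have "f ` verts J \<subseteq> verts K"
    using H vH unfolding subgraph_def by auto
  ultimately have "embedding K J f p q"
    using f paths disj unfolding embedding_def by blast
  moreover have "verts H = support J f p"
    using vH by (simp add: support_def)
  ultimately show "\<exists>f p q N. embedding K J f p q \<and> matching_on K (verts K - support J f p) N"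
    using N by metis
next
  assume "\<exists>f p q N. embedding K J f p q \<and> matching_on K (verts K - support J f p) N"
  then obtain f p q N where em: "embedding K J f p q"
    and N: "matching_on K (verts K - support J f p) N"
    by blast
  \<comment> \<open>The subgraph is recovered as the union of the paths.\<close>
  define H where "H = \<lparr>verts = support J f p, edges = (\<Union>e\<in>edges J. set (q e)), ends = ends K\<rparr>"
  have sv: "support J f p \<subseteq> verts K"
    by (rule support_subset_verts[OF J em])
  have eK: "edges H \<subseteq> edges K"
    using is_pathD(4)[OF embeddingD(3)[OF em]] by (auto simp: H_def)
  have ends_sub: "ends K d \<subseteq> support J f p" if "d \<in> edges H" for d
  proof -
    obtain e where e: "e \<in> edges J" "d \<in> set (q e)" using \<open>d \<in> edges H\<close> by (auto simp: H_def)
    show ?thesis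
      using is_path_edge_ends[OF embeddingD(3)[OF em e(1)] e(2)]
        set_path_subset_support[OF J em e(1)] by blast
  qed
  have "finite (edges H)" "finite (verts H)"
    using finite_subset[OF eK] finite_subset[OF sv] K by (simp_all add: multigraph_def H_def)
  then have "multigraph H"
    using ends_sub eK K unfolding multigraph_def by (auto simp: H_def)
  then have "subgraph H K"
    using sv eK unfolding subgraph_def by (auto simp: H_def)
  then have "conformal H K"
    using N unfolding conformal_def del_verts_def perfect_matching_induced by (auto simp: H_def)
  moreover have "is_path H (p e) (q e)" if "e \<in> edges J" for e
    by (rule is_path_mono[OF embeddingD(3)[OF em that]])
      (use set_path_subset_support[OF J em that] that in \<open>auto simp: H_def\<close>)
  then have "bisubdivision H J"
    unfolding bisubdivision_def
    using em unfolding embedding_def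
    by (intro exI[of _ f] exI[of _ p] exI[of _ q]) (simp add: H_def support_def)
  ultimately show "based J K" unfolding based_def by blast
qed

text \<open>The segment \<open>ms\<close> between \<open>a\<close> and \<open>b\<close> on one path
  is exchanged for \<open>ms'\<close>. With \<open>ms\<close> empty this replaces the marker edge by
  a path; with \<open>ms'\<close> empty it replaces an excursion by the marker edge. Vertices of
  \<open>ms\<close> are released, so \<open>ms'\<close> need only avoid the remaining support, and
  equal parity of the two segments keeps the path even.\<close>

lemma embedding_reroute:
  assumes J: "multigraph J" and em: "embedding K J f p q" and e0: "e0 \<in> edges J"
    and p0: "p e0 = xs1 @ a # ms @ b # xs2"
    and path1: "is_path K (xs1 @ [a]) es1" and path2: "is_path K (b # xs2) es2"
    and es: "set es1 \<union> set es2 \<subseteq> set (q e0)"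
    and new: "is_path K (a # ms' @ [b]) fs"
    and fresh: "set ms' \<inter> (support J f p - set ms) = {}"
    and fresh_edges: "\<And>e. e \<in> edges J \<Longrightarrow> e \<noteq> e0 \<Longrightarrow> set fs \<inter> set (q e) = {}"
    and parity: "even (length ms) \<longleftrightarrow> even (length ms')"
  shows "embedding K J f (p(e0 := xs1 @ a # ms' @ b # xs2)) (q(e0 := es1 @ fs @ es2))"
    and "support J f (p(e0 := xs1 @ a # ms' @ b # xs2)) = support J f p - set ms \<union> set ms'"
proof -
  define P where "P = xs1 @ a # ms' @ b # xs2"
  \<comment> \<open>The vertices common to the old and the new path. Both ends of the path are among
    them, so the two interiors differ only in \<open>ms\<close> and \<open>ms'\<close>.\<close>
  define A where "A = set xs1 \<union> {a, b} \<union> set xs2"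
  note ends0 = embedding_path_ends[OF J em e0]
  have dist: "distinct (xs1 @ a # ms @ b # xs2)" using ends0(3) p0 by simp
  then have msA: "set ms \<inter> A = {}" by (auto simp: A_def)
  have setp: "set (p e0) = A \<union> set ms" by (auto simp: p0 A_def)
  have setP: "set P = A \<union> set ms'" by (auto simp: P_def A_def)
  have ms'A: "set ms' \<inter> A = {}"
    using set_path_subset_support[OF J em e0] setp msA fresh by blast
  have hdP: "hd P = hd (p e0)" and lastP: "last P = last (p e0)"
    by (simp_all add: P_def p0 hd_append)
  have hA: "hd (p e0) \<in> A" by (auto simp: p0 A_def hd_append)
  have lA: "last (p e0) \<in> A" by (auto simp: p0 A_def)
  have distP: "distinct P"
    using dist ms'A is_pathD(2)[OF new] by (auto simp: P_def A_def)
  have pathP: "is_path K P (es1 @ fs @ es2)"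
  proof -
    have "is_path K ((a # ms') @ b # xs2) (fs @ es2)"
      using is_path_join[of K "a # ms'" b fs xs2 es2] new path2 distP by (auto simp: P_def)
    then show ?thesis
      using is_path_join[OF path1, of "ms' @ b # xs2" "fs @ es2"] distP by (auto simp: P_def)
  qed
  have intP: "set (internal P) = A - {hd (p e0), last (p e0)} \<union> set ms'"
    using set_internal[OF distP] ends0(1) hA lA ms'A setP hdP lastP by (auto simp: P_def)
  have intp: "set (internal (p e0)) = A - {hd (p e0), last (p e0)} \<union> set ms"
    using ends0(6) setp msA hA lA by auto
  \<comment> \<open>Parity is compared on whole vertex lists, each of which is longer by two than
    its interior.\<close>
  have "even (length P) \<longleftrightarrow> even (length (p e0))"
    using parity by (simp add: P_def p0)
  moreover have "length P = length (internal P) + 2"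
    using length_internal[of P] hdP lastP ends0(1) by (simp add: P_def)
  moreover have "length (p e0) = length (internal (p e0)) + 2"
    using length_internal[of "p e0"] ends0(1,2) by simp
  ultimately have evP: "even (length (internal P))"
    using embeddingD(5)[OF em e0] by simp
  have ms'f: "set ms' \<inter> f ` verts J = {}"
    using fresh embeddingD(6)[OF em e0] intp unfolding support_def by blast
  have ms'int: "set ms' \<inter> set (internal (p e)) = {}" if "e \<in> edges J" "e \<noteq> e0" for e
    using fresh embeddingD(7)[OF em e0 that(1)] that intp unfolding support_def by blast
  have int_disj: "set (internal P) \<inter> set (internal (p e)) = {}" if "e \<in> edges J" "e \<noteq> e0" for e
    using embeddingD(7)[OF em e0 that(1)] that intp intP ms'int[OF that] by blast
  have q_disj: "set (es1 @ fs @ es2) \<inter> set (q e) = {}" if "e \<in> edges J" "e \<noteq> e0" for e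
    using embeddingD(8)[OF em e0 that(1)] that es fresh_edges[OF that] by auto
  have Pf: "set (internal P) \<inter> f ` verts J = {}"
    using embeddingD(6)[OF em e0] intp intP ms'f by blast
  show "embedding K J f (p(e0 := xs1 @ a # ms' @ b # xs2)) (q(e0 := es1 @ fs @ es2))"
    unfolding P_def[symmetric] embedding_def
  proof (intro conjI ballI impI)
    fix e e' assume ee: "e \<in> edges J" "e' \<in> edges J" "e \<noteq> e'"
    show "set (internal ((p(e0 := P)) e)) \<inter> set (internal ((p(e0 := P)) e')) = {}"
      using ee embeddingD(7)[OF em ee] int_disj[of e] int_disj[of e'] by auto
    show "set ((q(e0 := es1 @ fs @ es2)) e) \<inter> set ((q(e0 := es1 @ fs @ es2)) e') = {}"
      using ee embeddingD(8)[OF em ee] q_disj[of e] q_disj[of e']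
      by (cases "e = e0"; cases "e' = e0") (simp_all add: Int_commute)
  next
    fix e assume e: "e \<in> edges J"
    show "is_path K ((p(e0 := P)) e) ((q(e0 := es1 @ fs @ es2)) e)"
      "{hd ((p(e0 := P)) e), last ((p(e0 := P)) e)} = f ` ends J e"
      "even (length (internal ((p(e0 := P)) e)))"
      "set (internal ((p(e0 := P)) e)) \<inter> f ` verts J = {}"
      using embeddingD(3-6)[OF em e] pathP hdP lastP evP Pf by auto
  qed (use embeddingD(1,2)[OF em] in auto)
  have "(\<Union>e\<in>edges J. set (internal ((p(e0 := P)) e))) =
      set (internal P) \<union> (\<Union>e\<in>edges J - {e0}. set (internal (p e)))"
    using e0 by (auto split: if_splits)
  moreover have "(\<Union>e\<in>edges J. set (internal (p e))) =
      set (internal (p e0)) \<union> (\<Union>e\<in>edges J - {e0}. set (internal (p e)))"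
    using e0 by auto
  moreover have "set ms \<inter> (f ` verts J \<union> (\<Union>e\<in>edges J - {e0}. set (internal (p e)))) = {}"
    using embeddingD(6,7)[OF em e0] intp by blast
  ultimately show "support J f (p(e0 := xs1 @ a # ms' @ b # xs2)) = support J f p - set ms \<union> set ms'"
    unfolding P_def[symmetric] support_def using intp intP msA by auto
qed

text \<open>Both ends of a path edge lie on the path, so an induced subgraph that contains the
  support contains all path edges too.\<close>

lemma embedding_induced:
  assumes K: "multigraph K" and J: "multigraph J" and Y: "Y \<subseteq> verts K"
  shows "embedding (induced K Y) J f p q \<longleftrightarrow> embedding K J f p q \<and> support J f p \<subseteq> Y"
proof
  assume em: "embedding (induced K Y) J f p q"
  have "is_path K (p e) (q e)" if "e \<in> edges J" for e
    by (rule is_path_mono[OF embeddingD(3)[OF em that]])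
      (use is_pathD(3,4)[OF embeddingD(3)[OF em that]] Y in \<open>auto simp: induced_def\<close>)
  then show "embedding K J f p q \<and> support J f p \<subseteq> Y"
    using em support_subset_verts[OF J em] Y unfolding embedding_def
    by (auto simp: induced_def)
next
  assume *: "embedding K J f p q \<and> support J f p \<subseteq> Y"
  then have em: "embedding K J f p q" and sub: "support J f p \<subseteq> Y" by auto
  have "is_path (induced K Y) (p e) (q e)" if "e \<in> edges J" for e
  proof -
    have pe: "is_path K (p e) (q e)" "set (p e) \<subseteq> Y"
      using embeddingD(3)[OF em that] set_path_subset_support[OF J em that] sub by auto
    have "ends K d \<subseteq> Y" if "d \<in> set (q e)" for d
      using is_path_edge_ends[OF pe(1) that] pe(2) by blast
    then show ?thesis
      by (intro is_path_mono[OF pe(1)]) (use pe is_pathD(4)[OF pe(1)] in \<open>auto simp: induced_def\<close>)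
  qed
  then show "embedding (induced K Y) J f p q"
    using em sub unfolding embedding_def support_def by (auto simp: induced_def)
qed

section \<open>Matchings of a part of the graph that is attached through a small set\<close>

lemma matching_on_induced:
  assumes "X \<subseteq> Y"
  shows "matching_on (induced K Y) X N \<longleftrightarrow> matching_on K X N"
proof -
  have ends: "ends (induced K Y) = ends K" by (simp add: induced_def)
  have "N \<subseteq> edges (induced K Y) \<longleftrightarrow> N \<subseteq> edges K" if "\<forall>e\<in>N. ends K e \<subseteq> X"
    using assms that by (auto simp: induced_def)
  then show ?thesis unfolding matching_on_def ends by argo
qed

text \<open>\<open>T\<close> consists of the vertices of \<open>S\<close> that \<open>M\<close>
  matches into \<open>Y\<close>. The matching edge at such a vertex is unique and meets
  \<open>Y\<close>, so the edges meeting \<open>Y\<close> match \<open>Y \<union> T\<close>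
  perfectly; counting its vertices gives the parity.\<close>

lemma matching_boundary:
  assumes K: "multigraph K" and M: "matching_on K X M" and "Y \<subseteq> X" "finite X" "Y \<inter> S = {}"
    and bd: "\<And>e. e \<in> M \<Longrightarrow> ends K e \<inter> Y \<noteq> {} \<Longrightarrow> ends K e \<subseteq> Y \<union> S"
  defines "T \<equiv> {s \<in> S. \<exists>e\<in>M. s \<in> ends K e \<and> ends K e \<inter> Y \<noteq> {}}"
  shows "matching_on K (Y \<union> T) {e \<in> M. ends K e \<subseteq> Y \<union> T}"
    and "even (card Y) \<longleftrightarrow> even (card T)"
proof -
  have TX: "T \<subseteq> X" using matching_onD(2)[OF M] unfolding T_def by blast
  show m: "matching_on K (Y \<union> T) {e \<in> M. ends K e \<subseteq> Y \<union> T}"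
  proof (rule matching_on_restrict[OF M])
    fix e assume e: "e \<in> M" "ends K e \<inter> (Y \<union> T) \<noteq> {}"
    have "ends K e \<inter> Y \<noteq> {}"
    proof (cases "ends K e \<inter> T = {}")
      case False
      then obtain s e' where "s \<in> ends K e" "e' \<in> M" "s \<in> ends K e'" "ends K e' \<inter> Y \<noteq> {}"
        unfolding T_def by blast
      then show ?thesis using matching_on_unique[OF M e(1)] by metis
    qed (use e in blast)
    then show "ends K e \<subseteq> Y \<union> T" using bd[OF e(1)] e(1) unfolding T_def by blast
  qed (use assms TX in auto)
  have "finite Y" "finite T" "Y \<inter> T = {}"
    using assms(3-5) TX finite_subset unfolding T_def by blast+
  then have "card (Y \<union> T) = card Y + card T" by (rule card_Un_disjoint)
  then show "even (card Y) \<longleftrightarrow> even (card T)"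
    using matching_on_even[OF K m] by simp
qed

text \<open>Turns the parity statement into a dichotomy: a perfect matching sends both vertices of
  \<open>S\<close> into an even side, or neither.\<close>

lemma even_card_subset_pair:
  assumes "card S = 2" "T \<subseteq> S" "even (card T)"
  shows "T = {} \<or> T = S"
proof -
  have fin: "finite S" using assms(1) card.infinite by fastforce
  then have "card T \<le> 2" using card_mono[OF fin assms(2)] assms(1) by simp
  with assms(3) have "card T = 0 \<or> card T = 2" by (metis One_nat_def Suc_1 dvd_refl le_Suc_eq odd_one le_zero_eq)
  then show ?thesis
    using assms(1,2) fin card_subset_eq[OF fin assms(2)] finite_subset[OF assms(2) fin] by auto
qed

section \<open>The two sides of a vertex pair\<close>

text \<open>The edge \<open>z\<close> is the marker edge: with \<open>K = G + z\<close>, the graph \<open>G\<close> and the marked components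
  both live inside \<open>K\<close>.\<close>

locale separated =
  fixes K :: "('v, 'e) mgraph" and z :: 'e and S L R :: "'v set"
  assumes K: "multigraph K" and z: "z \<in> edges K" and ends_z: "ends K z = S"
    and verts_K: "verts K = S \<union> L \<union> R"
    and disj: "S \<inter> L = {}" "S \<inter> R = {}" "L \<inter> R = {}"
    and no_cross: "\<And>e. e \<in> edges K \<Longrightarrow> ends K e \<inter> L = {} \<or> ends K e \<inter> R = {}"
begin

lemma card_S: "card S = 2"
  using K z ends_z unfolding multigraph_def by blast

lemma finite_verts: "finite (verts K)"
  using K unfolding multigraph_def by blast

lemma swap: "separated K z S R L"
  using K z ends_z verts_K disj no_cross by unfold_locales blast+

text \<open>No edge joins \<open>L\<close> to \<open>R\<close>, so consecutive vertices outside
  \<open>S\<close> stay on the same side.\<close>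

lemma path_one_side:
  assumes "is_path K xs es" "set xs \<inter> S = {}"
  shows "set xs \<inter> L = {} \<or> set xs \<inter> R = {}"
  using assms
proof (induction xs arbitrary: es)
  case (Cons x ys)
  show ?case
  proof (cases "ys = []")
    case True
    then show ?thesis using disj by auto
  next
    case False
    obtain e es' where es: "es = e # es'"
      using Cons.prems(1) False by (cases es) (auto simp: is_path_def)
    have e: "e \<in> edges K" "ends K e = {x, hd ys}" "x \<in> verts K" "is_path K ys es'"
      using Cons.prems(1) by (simp_all add: es is_path_Cons)
    have h: "hd ys \<in> set ys" "hd ys \<in> verts K" "set ys \<subseteq> verts K"
      using False is_pathD(3)[OF e(4)] by auto
    have "set ys \<inter> L = {} \<or> set ys \<inter> R = {}"
      using Cons.IH[OF e(4)] Cons.prems(2) by auto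
    moreover have "{x, hd ys} \<inter> L = {} \<or> {x, hd ys} \<inter> R = {}"
      using no_cross[OF e(1)] e(2) by simp
    moreover have "x \<notin> S" "hd ys \<notin> S" using Cons.prems(2) h(1) by auto
    ultimately show ?thesis using h e(3) verts_K by auto
  qed
qed simp

lemma edge_from_R:
  assumes "e \<in> edges K" "ends K e = {x, r}" "r \<in> R" "x \<notin> R"
  shows "x \<in> S"
proof -
  have "x \<in> verts K" using assms K unfolding multigraph_def by blast
  then show ?thesis using no_cross[OF assms(1)] assms verts_K by auto
qed

text \<open>The path enters \<open>R\<close> from a vertex \<open>a\<close> of \<open>S\<close> and
  returns to a vertex \<open>b\<close> of \<open>S\<close>. These exhaust \<open>S\<close>, so there
  is no second visit, and the vertices in \<open>R\<close> form one segment.\<close>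

lemma excursion:
  assumes path: "is_path K xs es" and "hd xs \<notin> R" "last xs \<notin> R" "set xs \<inter> R \<noteq> {}"
  obtains xs1 a ms b xs2 es1 es2 where "xs = xs1 @ a # ms @ b # xs2" "S = {a, b}"
    "set ms = set xs \<inter> R" "is_path K (xs1 @ [a]) es1" "is_path K (b # xs2) es2"
    "set es1 \<union> set es2 \<subseteq> set es"
proof -
  \<comment> \<open>\<open>r\<close> is the first vertex in \<open>R\<close>, and \<open>b\<close>
    below is the first vertex after \<open>r\<close> outside \<open>R\<close>.\<close>
  obtain ys r zs where xs: "xs = ys @ r # zs" "r \<in> R" "\<forall>y\<in>set ys. y \<notin> R"
    using split_list_first_prop[of xs "\<lambda>x. x \<in> R"] assms(4) by blast
  have "ys \<noteq> []" using xs assms(2) by auto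
  then obtain xs1 a where ys: "ys = xs1 @ [a]" by (cases ys rule: rev_cases) auto
  have "zs \<noteq> []" "last zs \<notin> R" using xs assms(3) by (auto split: if_splits)
  then obtain ms' b xs2 where zs: "zs = ms' @ b # xs2" "b \<notin> R" "\<forall>y\<in>set ms'. y \<in> R"
    using split_list_first_prop[of zs "\<lambda>x. x \<notin> R"] last_in_set by blast
  define ms where "ms = r # ms'"
  have xs': "xs = xs1 @ a # ms @ b # xs2" using xs ys zs by (simp add: ms_def)
  obtain es1 gs where 1: "es = es1 @ gs" "is_path K (xs1 @ [a]) es1" "is_path K (a # ms @ b # xs2) gs"
    using is_path_append[OF path[unfolded xs']] by blast
  obtain fs es2 where 2: "gs = fs @ es2" "is_path K ((a # ms) @ [b]) fs" "is_path K (b # xs2) es2"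
    using is_path_append[of K "a # ms" b xs2 gs] 1(3) by auto
  have "a \<in> S"
  proof -
    obtain e fs' where "fs = e # fs'" using 2(2) by (cases fs) (auto simp: is_path_def)
    then have "e \<in> edges K" "ends K e = {a, r}" using 2(2) by (simp_all add: is_path_Cons ms_def)
    then show ?thesis using edge_from_R xs ys by auto
  qed
  have "b \<in> S"
  proof -
    obtain ms'' r' where ms: "ms = ms'' @ [r']"
      by (metis ms_def append_butlast_last_id list.distinct(1))
    then have "r' \<in> R" using zs(3) xs(2) by (metis in_set_conv_decomp ms_def set_ConsD)
    obtain hs where "is_path K (r' # [b]) hs"
      using is_path_append[of K "a # ms''" r' "[b]" fs] 2(2) ms by auto
    moreover from this obtain e hs' where "hs = e # hs'" by (cases hs) (auto simp: is_path_def)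
    ultimately have "e \<in> edges K" "ends K e = {b, r'}"
      by (auto simp: is_path_Cons)
    then show ?thesis using edge_from_R \<open>r' \<in> R\<close> zs(2) by blast
  qed
  have dist: "distinct xs" using is_pathD(2)[OF path] .
  then have "a \<noteq> b" by (auto simp: xs')
  then have S: "S = {a, b}"
    using \<open>a \<in> S\<close> \<open>b \<in> S\<close> card_S by (auto simp: card_2_iff)
  \<comment> \<open>After \<open>b\<close> the path avoids \<open>S\<close>, hence stays on one
    side, and its last vertex is not in \<open>R\<close>.\<close>
  have "set xs2 \<inter> R = {}"
  proof (cases "xs2 = []")
    case False
    obtain e es' where "es2 = e # es'" using 2(3) False by (cases es2) (auto simp: is_path_def)
    then have p: "is_path K xs2 es'" using 2(3) by (simp add: is_path_Cons)
    have "set xs2 \<inter> S = {}" using dist by (auto simp: xs' S)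
    moreover have "last xs2 \<notin> R" "last xs2 \<in> set xs2" using assms(3) False by (auto simp: xs')
    ultimately show ?thesis
      using path_one_side[OF p] is_pathD(3)[OF p] verts_K by blast
  qed simp
  moreover have "set ms \<subseteq> R" using zs xs by (auto simp: ms_def)
  ultimately have "set ms = set xs \<inter> R"
    using xs(3) ys zs(2) by (auto simp: xs')
  moreover have "set es1 \<union> set es2 \<subseteq> set es" using 1 2 by auto
  ultimately show ?thesis using that xs' S 1 2 by blast
qed

text \<open>There are three ways in which the marker edge \<open>z\<close> can occur. If it lies on
  a path, an alternating path of \<open>M1\<close> and \<open>M2\<close> through \<open>R\<close>
  replaces it. If it lies in \<open>N\<close>, then \<open>M1\<close> replaces it and matches
  \<open>R\<close> as well. If it does not occur, \<open>M2\<close> matches \<open>R\<close>. As no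
  edge of \<open>M1\<close> joins the two vertices of \<open>S\<close>, the marker is not brought
  back.\<close>

lemma embedding_expand_marker:
  assumes J: "multigraph J" and em: "embedding K J f p q" and sup: "support J f p \<subseteq> L \<union> S"
    and N: "matching_on K (L \<union> S - support J f p) N"
    and M1: "matching_on K (R \<union> S) M1" "\<And>e. e \<in> M1 \<Longrightarrow> ends K e \<noteq> S"
    and M2: "matching_on K R M2"
  shows "\<exists>p q N. embedding K J f p q \<and> (\<forall>e\<in>edges J. z \<notin> set (q e)) \<and>
    matching_on K (verts K - support J f p) N \<and> z \<notin> N"
proof (cases "\<exists>e0\<in>edges J. z \<in> set (q e0)")
  case True
  then obtain e0 where e0: "e0 \<in> edges J" "z \<in> set (q e0)" by blast
  obtain xs1 a b xs2 es1 es2 where sp: "p e0 = xs1 @ a # b # xs2" "q e0 = es1 @ z # es2"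
      "is_path K (xs1 @ [a]) es1" "is_path K (b # xs2) es2" "ends K z = {a, b}"
    using is_path_edge_split[OF embeddingD(3)[OF em e0(1)] e0(2)] .
  have S: "S = {a, b}" using sp ends_z by simp
  have dist: "distinct (xs1 @ a # b # xs2)"
    using embedding_path_ends(3)[OF J em e0(1)] sp by simp
  have RS: "insert a (insert b R) = R \<union> S" using S by auto
  have M1': "matching_on K (insert a (insert b R)) M1"
    unfolding RS by (rule M1(1))
  have ab: "insert a (insert b R) \<subseteq> verts K" "a \<noteq> b" "a \<notin> R" "b \<notin> R"
    using verts_K dist disj(2) S by auto
  have "finite R" using finite_verts verts_K by simp
  then obtain ms fs N2 where alt: "is_path K (a # ms @ [b]) fs" "set ms \<subseteq> R" "even (length ms)"
    "set fs \<subseteq> M1 \<union> M2" "matching_on K (R - set ms) N2" "N2 \<subseteq> M2"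
    using alternating_path[OF K _ M1' M2 ab] by blast
  \<comment> \<open>Each edge of the alternating path has an end in \<open>R\<close>, so it differs
    from \<open>z\<close> and from every edge of an embedding supported in
    \<open>L \<union> S\<close>.\<close>
  have fs_ends: "\<not> ends K d \<subseteq> L \<union> S" if d: "d \<in> set fs" for d
  proof
    assume sub: "ends K d \<subseteq> L \<union> S"
    have c: "card (ends K d) = 2"
      using is_pathD(4)[OF alt(1)] d K unfolding multigraph_def by blast
    have "d \<in> M1 \<or> d \<in> M2" using alt(4) d by blast
    then show False
    proof
      assume "d \<in> M1"
      then have "ends K d \<subseteq> S" using matching_onD(2)[OF M1(1)] sub disj by blast
      then have "ends K d = S" using card_subset_eq[of S] c card_S S by simp
      then show False using M1(2) \<open>d \<in> M1\<close> by blast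
    next
      assume "d \<in> M2"
      then have "ends K d = {}" using matching_onD(2)[OF M2] sub disj by blast
      then show False using c by simp
    qed
  qed
  define p' q' where "p' = p(e0 := xs1 @ a # ms @ b # xs2)" and "q' = q(e0 := es1 @ fs @ es2)"
  have fe: "set fs \<inter> set (q e) = {}" if "e \<in> edges J" "e \<noteq> e0" for e
    using is_path_edge_ends[OF embeddingD(3)[OF em that(1)]] fs_ends
      set_path_subset_support[OF J em that(1)] sup by blast
  have p0: "p e0 = xs1 @ a # [] @ b # xs2" using sp by simp
  have es: "set es1 \<union> set es2 \<subseteq> set (q e0)" using sp(2) by auto
  have fresh: "set ms \<inter> (support J f p - set []) = {}" using alt(2) sup disj by blast
  have parity: "even (length []) \<longleftrightarrow> even (length ms)" using alt(3) by simp
  note reroute = embedding_reroute[OF J em e0(1) p0 sp(3,4) es alt(1) fresh fe parity]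
  have em': "embedding K J f p' q'" and sup': "support J f p' = support J f p \<union> set ms"
    using reroute by (simp_all add: p'_def q'_def)
  have "z \<notin> set fs" using fs_ends ends_z by blast
  \<comment> \<open>Each of the two remaining pieces contains only one of the ends \<open>a\<close>
    and \<open>b\<close> of \<open>z\<close>.\<close>
  moreover have "z \<notin> set es1" "z \<notin> set es2"
    using is_path_edge_ends[OF sp(3), of z] is_path_edge_ends[OF sp(4), of z] sp(5) dist by auto
  ultimately have zq: "\<forall>e\<in>edges J. z \<notin> set (q' e)"
    using embeddingD(8)[OF em e0(1)] e0(2) by (auto simp: q'_def)
  have "S \<subseteq> support J f p"
    using set_path_subset_support[OF J em e0(1)] by (auto simp: sp S)
  then have "z \<notin> N" using matching_onD(2)[OF N, of z] ends_z S by auto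
  moreover have "z \<notin> N2" using matching_onD(2)[OF M2, of z] alt(6) ends_z S disj by auto
  moreover have "matching_on K ((L \<union> S - support J f p) \<union> (R - set ms)) (N \<union> N2)"
    using matching_on_Un[OF N alt(5)] disj by blast
  moreover have "(L \<union> S - support J f p) \<union> (R - set ms) = verts K - support J f p'"
    using sup disj alt(2) sup' verts_K by auto
  ultimately show ?thesis using em' zq by (metis Un_iff)
next
  case False
  have sup_R: "verts K - support J f p = (L \<union> S - support J f p) \<union> R"
    using sup disj verts_K by auto
  have S_ne: "S \<noteq> {}" using card_S by auto
  show ?thesis
  proof (cases "z \<in> N")
    case True
    \<comment> \<open>Here \<open>N\<close> matches the two vertices of \<open>S\<close> with each
      other; \<open>M1\<close> covers them together with \<open>R\<close> instead.\<close>
    have Sd: "S \<subseteq> L \<union> S - support J f p" using matching_onD(2)[OF N True] ends_z by simp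
    have "matching_on K ((L \<union> S - support J f p - S) \<union> (R \<union> S)) (N - {z} \<union> M1)"
      using matching_on_Un[OF matching_on_remove_edge[OF N True] M1(1)] ends_z disj by auto
    moreover have "(L \<union> S - support J f p - S) \<union> (R \<union> S) = verts K - support J f p"
      using Sd sup_R by blast
    moreover have "z \<notin> N - {z} \<union> M1" using M1(2) ends_z by blast
    ultimately show ?thesis using em False by metis
  next
    case z_N: False
    have "z \<notin> M2" using matching_onD(2)[OF M2, of z] ends_z disj S_ne by auto
    moreover have "matching_on K ((L \<union> S - support J f p) \<union> R) (N \<union> M2)"
      using matching_on_Un[OF N M2] disj by blast
    ultimately show ?thesis using em False z_N sup_R by (metis Un_iff)
  qed
qed

text \<open>At most one path visits \<open>R\<close>, and a single marker edge can replace its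
  excursion. The excursion is even since \<open>R\<close> is even and \<open>M\<close> matches the
  rest of \<open>R\<close> within itself. If no path visits \<open>R\<close>, then \<open>M\<close>
  sends neither or both vertices of \<open>S\<close> into \<open>R\<close>; in the second case the
  marker edge is put into the matching.\<close>

lemma embedding_contract_to_marker:
  assumes J: "multigraph J" and em: "embedding K J f p q" and zq: "\<And>e. e \<in> edges J \<Longrightarrow> z \<notin> set (q e)"
    and M: "matching_on K (verts K - support J f p) M"
    and f: "f ` verts J \<subseteq> L \<union> S"
    and unique: "\<And>e e'. e \<in> edges J \<Longrightarrow> e' \<in> edges J \<Longrightarrow> set (p e) \<inter> R \<noteq> {} \<Longrightarrow>
      set (p e') \<inter> R \<noteq> {} \<Longrightarrow> e = e'"
    and R: "even (card R)"
  shows "\<exists>p q N. embedding K J f p q \<and> support J f p \<subseteq> L \<union> S \<and>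
    matching_on K (L \<union> S - support J f p) N"
proof (cases "\<exists>e0\<in>edges J. set (p e0) \<inter> R \<noteq> {}")
  case True
  then obtain e0 where e0: "e0 \<in> edges J" "set (p e0) \<inter> R \<noteq> {}" by blast
  have "hd (p e0) \<notin> R" "last (p e0) \<notin> R"
    using embedding_path_ends(4,5)[OF J em e0(1)] f disj by blast+
  then obtain xs1 a ms b xs2 es1 es2 where ex: "p e0 = xs1 @ a # ms @ b # xs2" "S = {a, b}"
    "set ms = set (p e0) \<inter> R" "is_path K (xs1 @ [a]) es1" "is_path K (b # xs2) es2"
    "set es1 \<union> set es2 \<subseteq> set (q e0)"
    using excursion[OF embeddingD(3)[OF em e0(1)]] e0(2) by metis
  have S_sup: "S \<subseteq> support J f p"
    using set_path_subset_support[OF J em e0(1)] by (auto simp: ex(1,2))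
  have dist: "distinct (xs1 @ a # ms @ b # xs2)"
    using embedding_path_ends(3)[OF J em e0(1)] ex(1) by simp
  have "set (internal (p e)) \<inter> R \<subseteq> set ms" if "e \<in> edges J" for e
    using unique[OF e0(1) that e0(2)] embedding_path_ends(7)[OF J em that] ex(3) by blast
  moreover have "set ms \<subseteq> support J f p"
    using set_path_subset_support[OF J em e0(1)] by (auto simp: ex(1))
  \<comment> \<open>By uniqueness no other path meets \<open>R\<close>, and no branch vertex lies
    there.\<close>
  ultimately have sup_R: "support J f p \<inter> R = set ms"
    using f disj ex(3) unfolding support_def by blast
  \<comment> \<open>Both vertices of \<open>S\<close> are on the path, so \<open>M\<close> avoids
    them and splits into a matching inside \<open>L\<close> and one inside \<open>R\<close>.\<close>
  have sides: "ends K e \<subseteq> Y - support J f p"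
    if "e \<in> M" "ends K e \<inter> (Y - support J f p) \<noteq> {}" "Y = L \<or> Y = R" for e Y
  proof -
    have "ends K e \<subseteq> L \<union> R - support J f p"
      using matching_onD(2)[OF M that(1)] S_sup verts_K by blast
    moreover have "ends K e \<inter> L = {} \<or> ends K e \<inter> R = {}"
      using no_cross matching_onD(1)[OF M] that(1) by blast
    ultimately show ?thesis using that(2,3) disj by blast
  qed
  have side_matching: "matching_on K (Y - support J f p) {e \<in> M. ends K e \<subseteq> Y - support J f p}"
    if "Y = L \<or> Y = R" for Y
  proof (rule matching_on_restrict[OF M])
    show "Y - support J f p \<subseteq> verts K - support J f p" using that verts_K by blast
  qed (rule sides[OF _ _ that])
  have "matching_on K (R - support J f p) {e \<in> M. ends K e \<subseteq> R - support J f p}"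
    by (rule side_matching) simp
  then have "even (card (R - set ms))"
    using matching_on_even[OF K] sup_R by (metis Diff_Int2 Int_commute Int_absorb)
  moreover have "card R = card (R - set ms) + card (set ms)"
    using finite_verts verts_K ex(3) by (metis Int_lower2 add.commute card_mono card_Diff_subset
      finite_Un finite_set le_add_diff_inverse)
  ultimately have "even (card (set ms))" using R by simp
  then have ev: "even (length ms)" using dist by (simp add: distinct_card)
  \<comment> \<open>The marker edge viewed as a path without internal vertices, in the form required
    for rerouting.\<close>
  have marker: "is_path K (a # [] @ [b]) [z]"
    using z ends_z ex(2) verts_K dist by (simp add: is_path_Cons is_path_single)
  define p' q' where "p' = p(e0 := xs1 @ a # [] @ b # xs2)" and "q' = q(e0 := es1 @ [z] @ es2)"
  have em': "embedding K J f p' q'" and sup': "support J f p' = support J f p - set ms"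
    unfolding p'_def q'_def
    using embedding_reroute[OF J em e0(1) ex(1,4,5,6) marker] ev zq by auto
  have "support J f p' \<subseteq> L \<union> S"
    using sup' sup_R support_subset_verts[OF J em] verts_K by blast
  moreover have "L \<union> S - support J f p' = L - support J f p"
    using sup' S_sup ex(3) disj by blast
  moreover have "matching_on K (L - support J f p) {e \<in> M. ends K e \<subseteq> L - support J f p}"
    by (rule side_matching) simp
  ultimately show ?thesis using em' by metis
next
  case False
  have "set (internal (p e)) \<inter> R = {}" if "e \<in> edges J" for e
    using False that embedding_path_ends(7)[OF J em that] by blast
  then have sup_R: "support J f p \<inter> R = {}"
    using f disj unfolding support_def by blast
  then have sup: "support J f p \<subseteq> L \<union> S"
    using support_subset_verts[OF J em] verts_K by blast
  define T where "T = {s \<in> S. \<exists>e\<in>M. s \<in> ends K e \<and> ends K e \<inter> R \<noteq> {}}"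
  have bd: "ends K e \<subseteq> Y \<union> S" if "e \<in> M" "ends K e \<inter> Y \<noteq> {}" "Y = L \<or> Y = R" for e Y
    using that no_cross[of e] matching_onD(1,2)[OF M] verts_K by blast
  have "even (card R) \<longleftrightarrow> even (card T)"
    unfolding T_def using finite_verts disj sup_R verts_K
    by (intro matching_boundary(2)[OF K M] bd) auto
  then have T: "T = {} \<or> T = S"
    using even_card_subset_pair[OF card_S, of T] R by (auto simp: T_def)
  show ?thesis
  proof (cases "T = {}")
    case True
    have "matching_on K (L \<union> S - support J f p) {e \<in> M. ends K e \<subseteq> L \<union> S - support J f p}"
    proof (rule matching_on_restrict[OF M])
      fix e assume e: "e \<in> M" "ends K e \<inter> (L \<union> S - support J f p) \<noteq> {}"
      have "ends K e \<inter> R = {}"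
        using e True no_cross[of e] matching_onD(1)[OF M] unfolding T_def by blast
      then show "ends K e \<subseteq> L \<union> S - support J f p"
        using matching_onD(2)[OF M e(1)] verts_K by blast
    qed (use verts_K in auto)
    then show ?thesis using em sup by blast
  next
    case False
    \<comment> \<open>Both vertices of \<open>S\<close> have partners in \<open>R\<close>. They are
      therefore outside the support, the rest of \<open>L\<close> is matched within itself, and
      \<open>z\<close> can match them with each other.\<close>
    then have TS: "T = S" using T by blast
    then have S_sup: "S \<inter> support J f p = {}"
      using matching_onD(2)[OF M] unfolding T_def by blast
    have "matching_on K (L - support J f p) {e \<in> M. ends K e \<subseteq> L - support J f p}"
    proof (rule matching_on_restrict[OF M])
      fix e assume e: "e \<in> M" "ends K e \<inter> (L - support J f p) \<noteq> {}"
      have "ends K e \<inter> S = {}"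
      proof (rule ccontr)
        assume "ends K e \<inter> S \<noteq> {}"
        then obtain s where s: "s \<in> ends K e" "s \<in> T" using TS by blast
        then obtain e' where "e' \<in> M" "s \<in> ends K e'" "ends K e' \<inter> R \<noteq> {}"
          unfolding T_def by blast
        then have "ends K e \<inter> R \<noteq> {}" using matching_on_unique[OF M e(1)] s by metis
        then show False using no_cross[of e] e matching_onD(1)[OF M] by blast
      qed
      then show "ends K e \<subseteq> L - support J f p"
        using matching_onD(2)[OF M e(1)] bd[of e L] e by blast
    qed (use verts_K in auto)
    from matching_on_Un[OF this matching_on_edge[OF z]]
    have "matching_on K ((L - support J f p) \<union> S) ({e \<in> M. ends K e \<subseteq> L - support J f p} \<union> {z})"
      using ends_z disj by auto
    moreover have "(L - support J f p) \<union> S = L \<union> S - support J f p"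
      using S_sup by blast
    ultimately show ?thesis using em sup by metis
  qed
qed

end

section \<open>Small mixed cuts of 3-connected cubic graphs\<close>

text \<open>At most two vertices and edges together cannot separate a 3-connected graph. By
  induction, a crossing edge of \<open>F\<close> is traded for one of its ends, which moves into
  \<open>X\<close>. The end is chosen on a side with a further vertex; such a side exists because
  more than three vertices, at most one of them in \<open>X\<close>, leave at least three in
  \<open>A\<close> and \<open>B\<close>. Without edges this is 3-connectedness.\<close>

lemma k_connected_mixed_cut:
  assumes J: "multigraph J" and conn: "k_connected 3 J" and "finite F"
    and "A \<union> B \<union> X = verts J" "A \<inter> B = {}" "A \<inter> X = {}" "B \<inter> X = {}"
    and "card X + card F \<le> 2"
    and "\<And>e. e \<in> edges J \<Longrightarrow> ends J e \<inter> A \<noteq> {} \<Longrightarrow> ends J e \<inter> B \<noteq> {} \<Longrightarrow> e \<in> F"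
  shows "A = {} \<or> B = {}"
  using assms(3-)
proof (induction F arbitrary: A B X rule: finite_induct)
  case empty
  show ?case
  proof (rule ccontr)
    assume "\<not> ?case"
    then obtain a b where ab: "a \<in> A" "b \<in> B" by blast
    have "X \<subseteq> verts J" "card X < 3" using empty.prems(1,5) by auto
    then have "connected_graph (del_verts J X)"
      using conn unfolding k_connected_def by blast
    then have "(a, b) \<in> (adj (del_verts J X))\<^sup>*"
      using ab empty.prems(1-4) unfolding connected_graph_def
      by (elim ballE) (auto simp: del_verts_def induced_def)
    then have "b \<in> A"
    proof (induction rule: rtrancl_induct)
      case (step x y)
      then obtain e where "e \<in> edges J" "ends J e \<subseteq> verts J - X" "ends J e = {x, y}"
        unfolding adj_def del_verts_def induced_def by auto
      then show ?case using empty.prems(1) empty.prems(6)[of e] step by auto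
    qed (rule ab)
    then show False using ab empty.prems(2) by blast
  qed
next
  case (insert d F)
  show ?case
  proof (cases "d \<in> edges J \<and> ends J d \<inter> A \<noteq> {} \<and> ends J d \<inter> B \<noteq> {}")
    case False
    have "card X + card F \<le> 2" using insert.prems(5) insert.hyps by simp
    moreover have "e \<in> F" if "e \<in> edges J" "ends J e \<inter> A \<noteq> {}" "ends J e \<inter> B \<noteq> {}" for e
      using insert.prems(6)[OF that] False that by blast
    ultimately show ?thesis using insert.IH[OF insert.prems(1-4)] by blast
  next
    case True
    then obtain a b where ab: "a \<in> A" "b \<in> B" "a \<in> ends J d" "b \<in> ends J d" by blast
    then have "a \<noteq> b" using insert.prems(2) by blast
    moreover have "card (ends J d) = 2" using True J unfolding multigraph_def by blast
    ultimately have d: "ends J d = {a, b}" using ab by (auto simp: card_2_iff)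
    have fin: "finite A" "finite B" "finite X"
      using J insert.prems(1) unfolding multigraph_def by (metis finite_Un)+
    have "card (verts J) = card A + card B + card X"
      using fin insert.prems(1-4) by (metis card_Un_disjoint finite_Un inf_sup_distrib2 sup_bot_right)
    moreover have "card X + card F \<le> 1" "3 < card (verts J)"
      using insert.prems(5) insert.hyps conn unfolding k_connected_def by auto
    ultimately have "3 \<le> card A + card B" by linarith
    then have "A \<noteq> {a} \<or> B \<noteq> {b}" by auto
    then show ?thesis
    proof
      assume A: "A \<noteq> {a}"
      have "A - {a} = {} \<or> B = {}"
      proof (rule insert.IH)
        show "(A - {a}) \<union> B \<union> insert a X = verts J" using insert.prems(1) ab by blast
        show "card (insert a X) + card F \<le> 2"
          using insert.prems(5) insert.hyps fin by (simp add: card_insert_if)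
        show "e \<in> F" if "e \<in> edges J" "ends J e \<inter> (A - {a}) \<noteq> {}" "ends J e \<inter> B \<noteq> {}" for e
        proof -
          have "e \<in> insert d F" using insert.prems(6)[OF that(1) _ that(3)] that(2) by blast
          moreover have "e \<noteq> d" using that(2) d insert.prems(2) ab by auto
          ultimately show ?thesis by blast
        qed
      qed (use insert.prems ab in blast)+
      then show ?thesis using A ab by blast
    next
      assume B: "B \<noteq> {b}"
      have "A = {} \<or> B - {b} = {}"
      proof (rule insert.IH)
        show "A \<union> (B - {b}) \<union> insert b X = verts J" using insert.prems(1) ab by blast
        show "card (insert b X) + card F \<le> 2"
          using insert.prems(5) insert.hyps fin by (simp add: card_insert_if)
        show "e \<in> F" if "e \<in> edges J" "ends J e \<inter> A \<noteq> {}" "ends J e \<inter> (B - {b}) \<noteq> {}" for e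
        proof -
          have "e \<in> insert d F" using insert.prems(6)[OF that(1,2)] that(3) by blast
          moreover have "e \<noteq> d" using that(3) d insert.prems(2) ab by auto
          ultimately show ?thesis by blast
        qed
      qed (use insert.prems ab in blast)+
      then show ?thesis using B ab by blast
    qed
  qed
qed

text \<open>In \<theta>, if both sides are nonempty, all three edges cross, which exceeds the
  bound.\<close>

lemma three_connected_cubic_mixed_cut:
  assumes J: "three_connected_cubic J" and F: "finite F"
    and part: "A \<union> B \<union> X = verts J" "A \<inter> B = {}" "A \<inter> X = {}" "B \<inter> X = {}"
    and card: "card X + card F \<le> 2"
    and cross: "\<And>e. e \<in> edges J \<Longrightarrow> ends J e \<inter> A \<noteq> {} \<Longrightarrow> ends J e \<inter> B \<noteq> {} \<Longrightarrow> e \<in> F"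
  shows "A = {} \<or> B = {}"
proof (cases "is_theta J")
  case False
  then show ?thesis
    using k_connected_mixed_cut[OF _ _ F part card cross] J
    unfolding three_connected_cubic_def by blast
next
  case True
  show ?thesis
  proof (rule ccontr)
    assume "\<not> ?thesis"
    then have "edges J \<subseteq> F"
      using cross True part(1) unfolding is_theta_def by blast
    then have "3 \<le> card F" using True card_mono[OF F] unfolding is_theta_def by fastforce
    then show False using card by simp
  qed
qed

section \<open>How an embedded bisubdivision of \<open>J\<close> meets the two sides\<close>

context separated
begin

text \<open>Pull \<open>S\<close> back to \<open>J\<close>: a vertex of \<open>S\<close> is hit by
  at most one branch vertex or by the interior of at most one path. This gives a mixed cut of size
  at most two between the branch vertices in \<open>L\<close> and those in \<open>R\<close>, so one
  of these classes is empty.\<close>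

lemma branch_vertices_one_side:
  assumes J: "three_connected_cubic J" and em: "embedding K J f p q"
  shows "f ` verts J \<subseteq> L \<union> S \<or> f ` verts J \<subseteq> R \<union> S"
proof -
  have mJ: "multigraph J" using J unfolding three_connected_cubic_def by blast
  define A B X F where "A = {x \<in> verts J. f x \<in> L}" and "B = {x \<in> verts J. f x \<in> R}"
    and "X = {x \<in> verts J. f x \<in> S}"
    and "F = {e \<in> edges J. set (internal (p e)) \<inter> S \<noteq> {}}"
  have finF: "finite F" and finX: "finite X"
    using mJ unfolding multigraph_def F_def X_def by auto
  \<comment> \<open>\<open>h\<close> charges each edge of \<open>F\<close> to a vertex of
    \<open>S\<close>. Distinct edges get distinct vertices, none of them a branch vertex, whence the
    size bound.\<close>
  obtain h where h: "\<And>e. e \<in> F \<Longrightarrow> h e \<in> set (internal (p e)) \<inter> S"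
    using bchoice[of F "\<lambda>e s. s \<in> set (internal (p e)) \<inter> S"] unfolding F_def by blast
  have FJ: "F \<subseteq> edges J" by (auto simp: F_def)
  have "inj_on h F"
  proof (rule inj_onI)
    fix e e' assume "e \<in> F" "e' \<in> F" "h e = h e'"
    then show "e = e'" using embeddingD(7)[OF em, of e e'] h[of e] h[of e'] FJ by auto
  qed
  moreover have "inj_on f X"
    using embeddingD(1)[OF em] by (rule inj_on_subset) (auto simp: X_def)
  moreover have "f ` X \<inter> h ` F = {}"
  proof (rule equals0I)
    fix s assume s: "s \<in> f ` X \<inter> h ` F"
    then obtain e where "e \<in> F" "s = h e" by blast
    then show False using embeddingD(6)[OF em, of e] h[of e] FJ s unfolding X_def by blast
  qed
  ultimately have "card X + card F = card (f ` X \<union> h ` F)"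
    using finF finX by (simp add: card_Un_disjoint card_image)
  also have "\<dots> \<le> card S"
  proof (rule card_mono)
    show "finite S" using card_S card.infinite by fastforce
    show "f ` X \<union> h ` F \<subseteq> S" using h by (auto simp: X_def)
  qed
  finally have card: "card X + card F \<le> 2" using card_S by simp
  have "A = {} \<or> B = {}"
  proof (rule three_connected_cubic_mixed_cut[OF J finF _ _ _ _ card])
    show "A \<union> B \<union> X = verts J"
      using embeddingD(2)[OF em] verts_K unfolding A_def B_def X_def by blast
    show "A \<inter> B = {}" "A \<inter> X = {}" "B \<inter> X = {}"
      using disj unfolding A_def B_def X_def by blast+
    fix e assume e: "e \<in> edges J" "ends J e \<inter> A \<noteq> {}" "ends J e \<inter> B \<noteq> {}"
    then obtain l r where "l \<in> f ` ends J e" "r \<in> f ` ends J e" "l \<in> L" "r \<in> R"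
      unfolding A_def B_def by blast
    then have lr: "l \<in> {hd (p e), last (p e)}" "r \<in> {hd (p e), last (p e)}" "l \<in> L" "r \<in> R"
      using embeddingD(4)[OF em e(1)] by auto
    \<comment> \<open>A path from \<open>L\<close> to \<open>R\<close> meets \<open>S\<close>; since
      its ends do not lie in \<open>S\<close>, it does so internally.\<close>
    then have "{hd (p e), last (p e)} \<inter> S = {}" using disj by auto
    moreover have "set (p e) \<inter> S \<noteq> {}"
      using path_one_side[OF embeddingD(3)[OF em e(1)]] lr
        embedding_path_ends(7)[OF mJ em e(1)] by blast
    ultimately show "e \<in> F"
      using embedding_path_ends(7)[OF mJ em e(1)] e(1) unfolding F_def by blast
  qed
  then show ?thesis
    using embeddingD(2)[OF em] verts_K unfolding A_def B_def by blast
qed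

lemma detour_through_S:
  assumes J: "multigraph J" and em: "embedding K J f p q" and f: "f ` verts J \<subseteq> L \<union> S"
    and e: "e \<in> edges J" "set (p e) \<inter> R \<noteq> {}"
  shows "S \<subseteq> set (p e)"
proof -
  have "hd (p e) \<notin> R" "last (p e) \<notin> R"
    using embedding_path_ends(4,5)[OF J em e(1)] f disj by blast+
  then obtain xs1 a ms b xs2 where "p e = xs1 @ a # ms @ b # xs2" "S = {a, b}"
    using excursion[OF embeddingD(3)[OF em e(1)] _ _ e(2)] by metis
  then show ?thesis by auto
qed

text \<open>Two paths that visit \<open>R\<close> both contain \<open>S\<close>. Paths of distinct
  edges share only branch vertices, so \<open>S\<close> is the set of ends of both, and
  \<open>e\<close> and \<open>e'\<close> are parallel in \<open>J\<close> with ends \<open>x\<close>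
  and \<open>y\<close>. By cubicity \<open>x\<close> has one further edge, which together with
  \<open>y\<close> separates \<open>x\<close> from all other vertices. So there are no others and
  the branch set is \<open>S\<close>, which is excluded.\<close>

lemma unique_detour:
  assumes J: "three_connected_cubic J" and em: "embedding K J f p q"
    and f: "f ` verts J \<subseteq> L \<union> S" "f ` verts J \<noteq> S"
    and e: "e \<in> edges J" "set (p e) \<inter> R \<noteq> {}" and e': "e' \<in> edges J" "set (p e') \<inter> R \<noteq> {}"
  shows "e = e'"
proof (rule ccontr)
  assume ne: "e \<noteq> e'"
  have mJ: "multigraph J" and cub: "cubic J"
    using J unfolding three_connected_cubic_def by auto
  have Sp: "S \<subseteq> set (p e)" "S \<subseteq> set (p e')"
    using detour_through_S[OF mJ em f(1)] e e' by blast+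
  have sub: "ends J d \<subseteq> verts J" "card (ends J d) = 2" if "d \<in> edges J" for d
    using mJ that unfolding multigraph_def by blast+
  have S_ends: "S = f ` ends J d"
    if "d \<in> {e, e'}" "d' \<in> {e, e'}" "d \<noteq> d'" for d d'
  proof -
    have d: "d \<in> edges J" "d' \<in> edges J" "S \<subseteq> set (p d)" "S \<subseteq> set (p d')"
      using that e(1) e'(1) Sp by auto
    have "S \<inter> set (internal (p d)) = {}"
    proof -
      have "S \<subseteq> f ` verts J \<union> set (internal (p d'))"
        using embedding_path_ends(4,5,7)[OF mJ em d(2)] d(4) by auto
      then show ?thesis
        using embeddingD(6)[OF em d(1)] embeddingD(7)[OF em d(1,2) that(3)] by blast
    qed
    then have "S \<subseteq> f ` ends J d"
      using d(3) embedding_path_ends(7)[OF mJ em d(1)] embeddingD(4)[OF em d(1)] by blast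
    moreover have fin: "finite (ends J d)" using sub(2)[OF d(1)] card.infinite by fastforce
    moreover have "card (f ` ends J d) \<le> card S"
      using card_image_le[OF fin, of f] sub(2)[OF d(1)] card_S by simp
    ultimately show ?thesis by (intro card_seteq) auto
  qed
  have "f ` ends J e = f ` ends J e'" using S_ends ne by blast
  then have same: "ends J e = ends J e'"
    using inj_on_image_eq_iff[OF embeddingD(1)[OF em]] sub(1) e(1) e'(1) by blast
  obtain x y where xy: "ends J e = {x, y}" "x \<noteq> y"
    using sub(2)[OF e(1)] by (auto simp: card_2_iff)
  have xyV: "x \<in> verts J" "y \<in> verts J" using xy sub(1)[OF e(1)] by auto
  \<comment> \<open>\<open>F\<close> contains just the third edge at \<open>x\<close>; the mixed cut
    is this edge and the vertex \<open>y\<close>.\<close>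
  define D F where "D = {d \<in> edges J. x \<in> ends J d}" and "F = D - {e, e'}"
  have "card D = 3" using cub xyV unfolding cubic_def D_def by blast
  moreover have "{e, e'} \<subseteq> D" using xy same e(1) e'(1) by (auto simp: D_def)
  ultimately have "card F = 1"
    unfolding F_def using ne by (subst card_Diff_subset) auto
  moreover have "finite F" using \<open>card D = 3\<close> card.infinite unfolding F_def by fastforce
  moreover have "d \<in> F"
    if "d \<in> edges J" "ends J d \<inter> {x} \<noteq> {}" "ends J d \<inter> (verts J - {x, y}) \<noteq> {}" for d
    using that xy same unfolding F_def D_def by auto
  ultimately have "{x} = {} \<or> verts J - {x, y} = {}"
    using xyV xy(2) by (intro three_connected_cubic_mixed_cut[OF J, of F _ _ "{y}"]) auto
  then have "verts J = ends J e" using xy xyV by auto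
  then show False using S_ends[of e e'] ne f(2) by simp
qed

text \<open>As \<open>S\<close> consists of branch vertices, the interior of a path avoids
  \<open>S\<close>. It is again a path, obtained by dropping the first and the last vertex.\<close>

lemma path_one_side_of_S:
  assumes J: "multigraph J" and em: "embedding K J f p q" and f: "f ` verts J = S"
    and e: "e \<in> edges J"
  shows "set (p e) \<inter> L = {} \<or> set (p e) \<inter> R = {}"
proof -
  note ends = embedding_path_ends[OF J em e]
  define ms where "ms = internal (p e)"
  have pe: "p e = hd (p e) # ms @ [last (p e)]"
    using path_split_ends[OF ends(2,1)] by (simp add: ms_def)
  have "set ms \<inter> L = {} \<or> set ms \<inter> R = {}"
  proof (cases ms rule: rev_cases)
    case (snoc ms' m)
    have path: "is_path K (hd (p e) # ms @ [last (p e)]) (q e)"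
      using embeddingD(3)[OF em e] pe by simp
    then obtain d es where "q e = d # es" by (cases "q e") (auto simp: is_path_def)
    then have "is_path K (ms' @ m # [last (p e)]) es"
      using path snoc by (simp add: is_path_Cons)
    then obtain es1 where "is_path K ms es1"
      using is_path_append[of K ms' m "[last (p e)]" es] snoc by auto
    then show ?thesis
      by (rule path_one_side) (use embeddingD(6)[OF em e] f in \<open>auto simp: ms_def\<close>)
  qed simp
  moreover have "{hd (p e), last (p e)} \<subseteq> S" using ends(4,5) f by simp
  ultimately show ?thesis using ends(7) disj unfolding ms_def by blast
qed

text \<open>Covers the case left out by \<open>unique_detour\<close>. Each of the three paths meets
  at most one of the two sides, so some side is met by at most one path.\<close>

lemma theta_detours:
  assumes J: "is_theta J" "multigraph J" and em: "embedding K J f p q" and f: "f ` verts J = S"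
  shows "(\<forall>e\<in>edges J. \<forall>e'\<in>edges J. set (p e) \<inter> R \<noteq> {} \<longrightarrow> set (p e') \<inter> R \<noteq> {} \<longrightarrow> e = e') \<or>
    (\<forall>e\<in>edges J. \<forall>e'\<in>edges J. set (p e) \<inter> L \<noteq> {} \<longrightarrow> set (p e') \<inter> L \<noteq> {} \<longrightarrow> e = e')"
proof -
  define D where "D Y = {e \<in> edges J. set (p e) \<inter> Y \<noteq> {}}" for Y
  have fin: "finite (edges J)" using J(2) unfolding multigraph_def by blast
  then have finD: "finite (D Y)" for Y unfolding D_def by simp
  have "D L \<inter> D R = {}"
    using path_one_side_of_S[OF J(2) em f] unfolding D_def by blast
  then have "card (D L) + card (D R) = card (D L \<union> D R)"
    using finD by (simp add: card_Un_disjoint)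
  also have "\<dots> \<le> 3"
    using card_mono[OF fin, of "D L \<union> D R"] J(1) unfolding is_theta_def D_def by auto
  finally have "card (D R) \<le> 1 \<or> card (D L) \<le> 1" by linarith
  then show ?thesis
  proof
    assume "card (D R) \<le> 1"
    then have "\<forall>e\<in>D R. \<forall>e'\<in>D R. e = e'" using card_le_Suc0_iff_eq[OF finD] by simp
    then show ?thesis unfolding D_def by blast
  next
    assume "card (D L) \<le> 1"
    then have "\<forall>e\<in>D L. \<forall>e'\<in>D L. e = e'" using card_le_Suc0_iff_eq[OF finD] by simp
    then show ?thesis unfolding D_def by blast
  qed
qed

end

section \<open>Marked components\<close>

text \<open>Taking all of \<open>verts G - S\<close> in place of a component makes \<open>K\<close>
  the graph \<open>G\<close> with the marker edge \<open>None\<close> added.\<close>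

context
  fixes G :: "('v, 'e) mgraph" and S :: "'v set" and K :: "('v, 'e option) mgraph"
  assumes G: "multigraph G" and S: "S \<subseteq> verts G" "card S = 2"
  defines "K \<equiv> marked_component G S (verts G - S)"
begin

lemma marked_simps:
  "verts K = verts G" "edges K = insert None (Some ` edges G)"
  "ends K None = S" "ends K (Some e) = ends G e"
proof -
  have "{e \<in> edges G. ends G e \<subseteq> verts G - S \<union> S} = edges G"
    using G unfolding multigraph_def by auto
  then show "verts K = verts G" "edges K = insert None (Some ` edges G)"
    "ends K None = S" "ends K (Some e) = ends G e"
    using S unfolding K_def marked_component_def induced_def by auto
qed

lemma marked_multigraph: "multigraph K"
  using G S unfolding multigraph_def by (auto simp: marked_simps)

text \<open>The marker edge has its ends in \<open>S\<close> and so survives every such restriction;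
  this puts all marked components inside the one graph \<open>K\<close>.\<close>

lemma marked_component_induced:
  "marked_component G S L = induced K (L \<union> S)"
proof -
  have "{e \<in> edges K. ends K e \<subseteq> L \<union> S} = insert None (Some ` {e \<in> edges G. ends G e \<subseteq> L \<union> S})"
    by (auto simp: marked_simps)
  moreover have "ends K = case_option S (ends G)"
    by (simp add: K_def marked_component_def)
  ultimately show ?thesis
    by (simp add: marked_component_def[of G S L] induced_def)
qed

section \<open>Transfer of matchings and embeddings between \<open>G\<close> and
  \<open>K\<close>\<close>

lemma matching_on_Some:
  "matching_on K X (Some ` M) \<longleftrightarrow> matching_on G X M"
  unfolding matching_on_def by (auto simp: marked_simps)

lemma matching_on_unmarked:
  assumes "matching_on K X N" "None \<notin> N"
  obtains M where "matching_on G X M"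
proof -
  have "Some ` {e. Some e \<in> N} = N"
    using assms(2) by (auto simp: image_iff) (metis option.exhaust)
  then show ?thesis using that matching_on_Some[of X "{e. Some e \<in> N}"] assms(1) by simp
qed

lemma embedding_Some:
  assumes "embedding G J f p q"
  shows "embedding K J f p (\<lambda>e. map Some (q e))"
proof -
  have "is_path K (p e) (map Some (q e))" if "e \<in> edges J" for e
    using is_path_transfer[OF embeddingD(3)[OF assms that], of K Some]
      is_pathD(3,4)[OF embeddingD(3)[OF assms that]] by (auto simp: marked_simps)
  moreover have "set (map Some (q e)) \<inter> set (map Some (q e')) = {}"
    if "e \<in> edges J" "e' \<in> edges J" "e \<noteq> e'" for e e'
    using embeddingD(8)[OF assms that] by auto
  ultimately show ?thesis
    using assms unfolding embedding_def by (simp add: marked_simps)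
qed

lemma embedding_unmarked:
  assumes em: "embedding K J f p q" and unmarked: "\<And>e. e \<in> edges J \<Longrightarrow> None \<notin> set (q e)"
  shows "embedding G J f p (\<lambda>e. map the (q e))"
proof -
  have ex: "\<exists>d'. d = Some d'" if "e \<in> edges J" "d \<in> set (q e)" for e d
    using unmarked[OF that(1)] that(2) by (cases d) auto
  have "is_path G (p e) (map the (q e))" if "e \<in> edges J" for e
  proof (rule is_path_transfer[OF embeddingD(3)[OF em that]])
    note P = is_pathD(3,4)[OF embeddingD(3)[OF em that]]
    show "set (p e) \<subseteq> verts G" using P by (simp add: marked_simps)
    show "the ` set (q e) \<subseteq> edges G" using P ex[OF that] by (force simp: marked_simps)
    show "ends G (the d) = ends K d" if "d \<in> set (q e)" for d
      using ex[OF \<open>e \<in> edges J\<close> that] by (auto simp: marked_simps)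
  qed
  moreover have "set (map the (q e)) \<inter> set (map the (q e')) = {}"
    if ee: "e \<in> edges J" "e' \<in> edges J" "e \<noteq> e'" for e e'
  proof (rule equals0I)
    fix x assume "x \<in> set (map the (q e)) \<inter> set (map the (q e'))"
    then obtain d d' where "d \<in> set (q e)" "d' \<in> set (q e')" "x = the d" "x = the d'" by auto
    then have "Some x \<in> set (q e)" "Some x \<in> set (q e')"
      using ex[OF ee(1), of d] ex[OF ee(2), of d'] by auto
    then show False using embeddingD(8)[OF em ee] by blast
  qed
  ultimately show ?thesis
    using em unfolding embedding_def by (simp add: marked_simps)
qed

text \<open>\<open>G\<close> is \<open>K\<close> without the marker, so \<open>None\<close> is
  barred both from the paths and from the matching; for marked components it is allowed in
  either.\<close>

lemma based_iff_unmarked_embedding: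
  assumes J: "multigraph J"
  shows "based J G \<longleftrightarrow> (\<exists>f p q N. embedding K J f p q \<and> (\<forall>e\<in>edges J. None \<notin> set (q e)) \<and>
    matching_on K (verts K - support J f p) N \<and> None \<notin> N)"
proof
  assume "based J G"
  then obtain f p q N where "embedding G J f p q" "matching_on G (verts G - support J f p) N"
    using based_iff_embedding[OF G J] by blast
  then have "embedding K J f p (\<lambda>e. map Some (q e))" "\<forall>e\<in>edges J. None \<notin> set (map Some (q e))"
    "matching_on K (verts K - support J f p) (Some ` N)" "None \<notin> Some ` N"
    using embedding_Some by (auto simp: marked_simps(1) matching_on_Some)
  then show "\<exists>f p q N. embedding K J f p q \<and> (\<forall>e\<in>edges J. None \<notin> set (q e)) \<and>
    matching_on K (verts K - support J f p) N \<and> None \<notin> N" by metis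
next
  assume "\<exists>f p q N. embedding K J f p q \<and> (\<forall>e\<in>edges J. None \<notin> set (q e)) \<and>
    matching_on K (verts K - support J f p) N \<and> None \<notin> N"
  then obtain f p q N where *: "embedding K J f p q" "\<forall>e\<in>edges J. None \<notin> set (q e)"
    "matching_on K (verts K - support J f p) N" "None \<notin> N" by blast
  obtain M where "matching_on G (verts K - support J f p) M"
    using matching_on_unmarked[OF *(3,4)] .
  then show "based J G"
    using based_iff_embedding[OF G J] embedding_unmarked[OF *(1)] *(2) marked_simps(1) by metis
qed

lemma based_marked_component_iff:
  assumes J: "multigraph J" and L: "L \<subseteq> verts G"
  shows "based J (marked_component G S L) \<longleftrightarrow> (\<exists>f p q N. embedding K J f p q \<and>
    support J f p \<subseteq> L \<union> S \<and> matching_on K (L \<union> S - support J f p) N)"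
proof -
  have Y: "L \<union> S \<subseteq> verts K" using L S by (simp add: marked_simps)
  then have "multigraph (induced K (L \<union> S))"
    using marked_multigraph finite_subset unfolding multigraph_def induced_def by auto
  from based_iff_embedding[OF this J] show ?thesis
    unfolding marked_component_induced embedding_induced[OF marked_multigraph J Y]
    by (simp add: induced_def[of K "L \<union> S"] matching_on_induced[unfolded induced_def])
qed

end

section \<open>The components of \<open>G - S\<close>\<close>

text \<open>Such sets are the unions of components of \<open>G - S\<close>. The notion is closed
  under complement, so the far side of a component, possibly several components, can be treated like
  a component.\<close>

definition attached :: "('v, 'e) mgraph \<Rightarrow> 'v set \<Rightarrow> 'v set \<Rightarrow> bool" where
  "attached G S X \<longleftrightarrow> X \<subseteq> verts G - S \<and> (\<forall>e\<in>edges G. ends G e \<inter> X \<noteq> {} \<longrightarrow> ends G e \<subseteq> X \<union> S)"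

lemma attached_complement:
  assumes "multigraph G" "attached G S X"
  shows "attached G S (verts G - S - X)"
  using assms unfolding attached_def multigraph_def by blast

lemma sym_adj: "sym (adj D)"
  unfolding adj_def sym_def by (auto simp: insert_commute)

lemma component_disjoint:
  assumes "C \<in> components D" "C' \<in> components D" "C \<noteq> C'"
  shows "C \<inter> C' = {}"
proof (rule ccontr)
  obtain u u' where u: "C = {v \<in> verts D. (u, v) \<in> (adj D)\<^sup>*}" "C' = {v \<in> verts D. (u', v) \<in> (adj D)\<^sup>*}"
    using assms unfolding components_def by blast
  assume "C \<inter> C' \<noteq> {}"
  then obtain w where w: "(u, w) \<in> (adj D)\<^sup>*" "(u', w) \<in> (adj D)\<^sup>*" using u by blast
  have "(w, u) \<in> (adj D)\<^sup>*" "(w, u') \<in> (adj D)\<^sup>*"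
    using w sym_rtrancl[OF sym_adj, of D] unfolding sym_def by blast+
  with w have "(u, u') \<in> (adj D)\<^sup>*" "(u', u) \<in> (adj D)\<^sup>*" by (blast intro: rtrancl_trans)+
  then have "C = C'" unfolding u by (blast intro: rtrancl_trans)
  then show False using assms by blast
qed

lemma Union_components: "\<Union> (components D) = verts D"
  unfolding components_def by auto

lemma component_nonempty: "C \<in> components D \<Longrightarrow> C \<noteq> {}"
  unfolding components_def by auto

lemma component_proper:
  assumes "\<not> connected_graph D" "C \<in> components D"
  shows "C \<noteq> verts D"
proof
  obtain u where u: "C = {v \<in> verts D. (u, v) \<in> (adj D)\<^sup>*}"
    using assms unfolding components_def by blast
  assume C: "C = verts D"
  have "(v, w) \<in> (adj D)\<^sup>*" if "v \<in> verts D" "w \<in> verts D" for v w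
  proof -
    have "(u, v) \<in> (adj D)\<^sup>*" "(u, w) \<in> (adj D)\<^sup>*" using C u that by blast+
    then show ?thesis
      using sym_rtrancl[OF sym_adj, of D] unfolding sym_def by (blast intro: rtrancl_trans)
  qed
  then show False using assms(1) unfolding connected_graph_def by blast
qed

lemma component_attached:
  assumes G: "multigraph G" and C: "C \<in> components (del_verts G S)"
  shows "attached G S C"
proof -
  define D where "D = del_verts G S"
  have D: "verts D = verts G - S" "edges D = {e \<in> edges G. ends G e \<subseteq> verts G - S}" "ends D = ends G"
    by (auto simp: D_def del_verts_def induced_def)
  obtain u where u: "C = {v \<in> verts D. (u, v) \<in> (adj D)\<^sup>*}"
    using C unfolding D_def components_def by blast
  have "ends G e \<subseteq> C \<union> S" if e: "e \<in> edges G" "ends G e \<inter> C \<noteq> {}" for e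
  proof
    fix y assume y: "y \<in> ends G e"
    obtain x where x: "x \<in> ends G e" "x \<in> C" using e by blast
    have ends: "ends G e \<subseteq> verts G" "card (ends G e) = 2"
      using G e(1) unfolding multigraph_def by auto
    show "y \<in> C \<union> S"
    proof (rule ccontr)
      assume n: "y \<notin> C \<union> S"
      then have "x \<noteq> y" using x by blast
      then have xy: "ends G e = {x, y}" using ends(2) x(1) y by (auto simp: card_2_iff)
      then have "e \<in> edges D" using e(1) x(2) n u ends(1) D by auto
      then have "(x, y) \<in> adj D" using xy D unfolding adj_def by auto
      then have "y \<in> C" using x(2) n ends(1) y D unfolding u by (auto intro: rtrancl_into_rtrancl)
      then show False using n by blast
    qed
  qed
  moreover have "C \<subseteq> verts G - S" using u D by auto
  ultimately show ?thesis unfolding attached_def by blast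
qed

lemma separated_marked:
  assumes G: "multigraph G" and S: "S \<subseteq> verts G" "card S = 2" and L: "attached G S L"
  shows "separated (marked_component G S (verts G - S)) None S L (verts G - S - L)"
proof -
  note simps = marked_simps[OF G S]
  show ?thesis
  proof
    fix e assume "e \<in> edges (marked_component G S (verts G - S))"
    then show "ends (marked_component G S (verts G - S)) e \<inter> L = {} \<or>
        ends (marked_component G S (verts G - S)) e \<inter> (verts G - S - L) = {}"
      using L unfolding attached_def by (cases e) (auto simp: simps)
  qed (use L S marked_multigraph[OF G S] in \<open>auto simp: simps attached_def\<close>)
qed

section \<open>Perfect matchings of \<open>G\<close> relative to \<open>S\<close>, and the parity of
  the components\<close>

lemma attached_boundary:
  assumes G: "multigraph G" and M: "matching_on G (verts G) M" and X: "attached G S X"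
  defines "T \<equiv> {s \<in> S. \<exists>e\<in>M. s \<in> ends G e \<and> ends G e \<inter> X \<noteq> {}}"
  shows "matching_on G (X \<union> T) {e \<in> M. ends G e \<subseteq> X \<union> T}"
    and "even (card X) \<longleftrightarrow> even (card T)"
proof -
  have fin: "finite (verts G)" using G unfolding multigraph_def by blast
  have bd: "ends G e \<subseteq> X \<union> S" if "e \<in> M" "ends G e \<inter> X \<noteq> {}" for e
    using that X matching_onD(1)[OF M] unfolding attached_def by blast
  have "X \<subseteq> verts G" "X \<inter> S = {}" using X unfolding attached_def by auto
  from matching_boundary[OF G M this(1) fin this(2) bd]
  show "matching_on G (X \<union> T) {e \<in> M. ends G e \<subseteq> X \<union> T}" "even (card X) \<longleftrightarrow> even (card T)"
    unfolding T_def by blast+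
qed

text \<open>Connectedness gives an edge between \<open>Y\<close> and \<open>S\<close>, and matching
  coveredness a perfect matching through it. As \<open>Y\<close> is even, this matching sends both
  vertices of \<open>S\<close> into \<open>Y\<close>; hence it splits into a matching of
  \<open>Y \<union> S\<close> and matchings of the parts away from \<open>Y\<close> and
  \<open>S\<close>. Exchanging the roles of two sides yields, for each side, a matching with
  \<open>S\<close> and one without.\<close>

lemma side_matchings:
  assumes mc: "matching_covered G" and S: "S \<subseteq> verts G" "card S = 2"
    and Y: "attached G S Y" "Y \<noteq> {}" "even (card Y)" and Z: "attached G S Z" "Y \<inter> Z = {}"
  obtains M1 M2 where "matching_on G (Y \<union> S) M1" "\<forall>e\<in>M1. ends G e \<noteq> S"
    "matching_on G Z M2"
proof -
  have G: "multigraph G" and conn: "connected_graph G"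
    using mc unfolding matching_covered_def by auto
  have S_ne: "S \<noteq> {}" using S by auto
  have "\<exists>e\<in>edges G. ends G e \<inter> Y \<noteq> {} \<and> ends G e \<inter> S \<noteq> {}"
  proof (rule ccontr)
    assume none: "\<not> ?thesis"
    obtain y s where ys: "y \<in> Y" "s \<in> S" using Y S_ne by blast
    then have "(y, s) \<in> (adj G)\<^sup>*"
      using conn S Y(1) unfolding connected_graph_def attached_def by blast
    then have "s \<in> Y"
    proof (induction rule: rtrancl_induct)
      case (step x w)
      then obtain e where "e \<in> edges G" "ends G e = {x, w}" unfolding adj_def by blast
      moreover from this have "ends G e \<inter> S = {}" using none step.IH by blast
      moreover have "ends G e \<subseteq> Y \<union> S" if "ends G e \<inter> Y \<noteq> {}"
        using Y(1) calculation(1) that unfolding attached_def by blast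
      ultimately show ?case using step.IH by auto
    qed (rule ys)
    then show False using Y(1) ys unfolding attached_def by blast
  qed
  then obtain e where e: "e \<in> edges G" "ends G e \<inter> Y \<noteq> {}" "ends G e \<inter> S \<noteq> {}" by blast
  then obtain M where "perfect_matching G M" "e \<in> M"
    using mc unfolding matching_covered_def by blast
  then have M: "matching_on G (verts G) M" "e \<in> M"
    using perfect_matching_iff_matching_on[OF G] by simp_all
  define T where "T = {s \<in> S. \<exists>e\<in>M. s \<in> ends G e \<and> ends G e \<inter> Y \<noteq> {}}"
  have "T \<noteq> {}" using e M(2) unfolding T_def by blast
  moreover have "even (card T)"
    using attached_boundary(2)[OF G M(1) Y(1)] Y(3) unfolding T_def by blast
  ultimately have TS: "T = S" using even_card_subset_pair[OF S(2), of T] by (auto simp: T_def)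
  have M1: "matching_on G (Y \<union> S) {e \<in> M. ends G e \<subseteq> Y \<union> S}"
    using attached_boundary(1)[OF G M(1) Y(1)] TS unfolding T_def by simp
  \<comment> \<open>Every matching edge at \<open>S\<close> ends in \<open>Y\<close>; so none joins
    the two vertices of \<open>S\<close>, and none leads from \<open>S\<close> into
    \<open>Z\<close>.\<close>
  have meets: "ends G d \<inter> Y \<noteq> {}" if d: "d \<in> M" "ends G d \<inter> S \<noteq> {}" for d
  proof -
    obtain s where s: "s \<in> ends G d" "s \<in> T" using d TS by blast
    then obtain d' where "d' \<in> M" "s \<in> ends G d'" "ends G d' \<inter> Y \<noteq> {}" unfolding T_def by blast
    then show ?thesis using matching_on_unique[OF M(1) d(1)] s(1) by metis
  qed
  have "ends G d \<noteq> S" if "d \<in> M" for d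
    using meets[OF that] Y(1) S_ne unfolding attached_def by blast
  moreover have "matching_on G Z {e \<in> M. ends G e \<subseteq> Z}"
  proof (rule matching_on_restrict[OF M(1)])
    fix d assume d: "d \<in> M" "ends G d \<inter> Z \<noteq> {}"
    then have "ends G d \<subseteq> Z \<union> S" using Z(1) matching_onD(1)[OF M(1)] unfolding attached_def by blast
    moreover from this have "ends G d \<inter> S = {}"
      using meets[OF d(1)] Z(2) Y(1) unfolding attached_def by blast
    ultimately show "ends G d \<subseteq> Z" by blast
  qed (use Z(1) in \<open>auto simp: attached_def\<close>)
  ultimately show ?thesis using that[OF M1] by blast
qed

text \<open>Connectedness on at least two vertices provides an edge, and every edge lies in a
  perfect matching.\<close>

lemma matching_covered_perfect_matching:
  assumes "matching_covered G"
  obtains M where "perfect_matching G M"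
proof -
  have conn: "connected_graph G" and card: "2 \<le> card (verts G)"
    using assms unfolding matching_covered_def by auto
  obtain U where "U \<subseteq> verts G" "card U = 2"
    using obtain_subset_with_card_n[OF card] by metis
  then obtain u v where uv: "u \<in> verts G" "v \<in> verts G" "u \<noteq> v"
    by (auto simp: card_2_iff)
  then have "(u, v) \<in> (adj G)\<^sup>*" using conn unfolding connected_graph_def by blast
  then have "edges G \<noteq> {}" using uv(3) by (cases rule: converse_rtranclE) (auto simp: adj_def)
  then show ?thesis using that assms unfolding matching_covered_def by blast
qed

text \<open>Since \<open>S\<close> has two elements, a perfect matching sends both of them into the same component,
  or into two different ones; in the latter case exactly these two components are odd.\<close>

lemma component_even:
  assumes mc: "matching_covered G" and sep: "two_separation G S" and C: "C \<in> components (del_verts G S)"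
  shows "even (card C)"
proof (rule ccontr)
  assume odd: "odd (card C)"
  have G: "multigraph G" using mc unfolding matching_covered_def by auto
  have S: "S \<subseteq> verts G" "card S = 2" and nb: "\<not> barrier G S"
    using sep unfolding two_separation_def by auto
  have verts_D: "verts (del_verts G S) = verts G - S" by (simp add: del_verts_def induced_def)
  obtain M where pm: "perfect_matching G M"
    using matching_covered_perfect_matching[OF mc] .
  then have M: "matching_on G (verts G) M" using perfect_matching_iff_matching_on[OF G] by simp
  define T where "T X = {s \<in> S. \<exists>e\<in>M. s \<in> ends G e \<and> ends G e \<inter> X \<noteq> {}}" for X
  have att: "attached G S X" if "X \<in> components (del_verts G S)" for X
    using component_attached[OF G that] .
  have parity: "even (card X) \<longleftrightarrow> even (card (T X))" if "X \<in> components (del_verts G S)" for X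
    using attached_boundary(2)[OF G M att[OF that]] unfolding T_def .
  have T_disj: "T X \<inter> T X' = {}"
    if X: "X \<in> components (del_verts G S)" "X' \<in> components (del_verts G S)" "X \<noteq> X'" for X X'
  proof (rule equals0I)
    fix s assume "s \<in> T X \<inter> T X'"
    then obtain e e' where e: "s \<in> S" "e \<in> M" "s \<in> ends G e" "ends G e \<inter> X \<noteq> {}"
      "e' \<in> M" "s \<in> ends G e'" "ends G e' \<inter> X' \<noteq> {}" unfolding T_def by blast
    then have "e = e'" using matching_on_unique[OF M] by blast
    then have "ends G e \<inter> X' \<noteq> {}" "ends G e \<subseteq> X \<union> S"
      using e att[OF X(1)] matching_onD(1)[OF M] unfolding attached_def by blast+
    then show False
      using component_disjoint[OF X] att[OF X(2)] unfolding attached_def by blast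
  qed
  \<comment> \<open>An odd subset of the pair \<open>S\<close> is a singleton, so exactly one vertex
    \<open>s\<close> of \<open>S\<close> is matched into \<open>C\<close>.\<close>
  have "odd (card (T C))" using parity[OF C] odd by simp
  then have "T C \<noteq> {}" "T C \<noteq> S" using S(2) by auto
  moreover have "T C \<subseteq> S" by (auto simp: T_def)
  ultimately obtain s t where st: "S = {s, t}" "s \<noteq> t" "T C = {s}"
    using S(2) unfolding card_2_iff by blast
  obtain d where d: "d \<in> M" "s \<in> ends G d" "ends G d \<inter> C \<noteq> {}"
    using st(3) unfolding T_def by blast
  obtain e y where e: "e \<in> M" "ends G e = {t, y}" "y \<noteq> t" "y \<in> verts G"
    using matching_on_partner[OF G M, of t] st(1) S(1) by auto
  \<comment> \<open>If \<open>t\<close> were matched to \<open>s\<close>, the matching edge at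
    \<open>s\<close> would have no end in \<open>C\<close>; so \<open>t\<close> is matched into some
    component \<open>C'\<close>.\<close>
  have "y \<noteq> s"
  proof
    assume "y = s"
    then have "e = d" using matching_on_unique[OF M e(1) d(1)] e(2) d(2) by blast
    then have "t \<in> T C" using d e st(1) unfolding T_def by blast
    then show False using st by simp
  qed
  then have "y \<in> \<Union> (components (del_verts G S))"
    unfolding Union_components verts_D using e st(1) by simp
  then obtain C' where C': "C' \<in> components (del_verts G S)" "y \<in> C'" by blast
  have tC': "t \<in> T C'" using e C' st(1) unfolding T_def by blast
  then have ne: "C \<noteq> C'" using st by auto
  then have TC': "T C' = {t}" using T_disj[OF C C'(1)] tC' st unfolding T_def by auto
  \<comment> \<open>Both vertices of \<open>S\<close> are used up by \<open>C\<close> and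
    \<open>C'\<close>, so every other component is matched within itself and is even. Two odd
    components make \<open>S\<close> a barrier.\<close>
  have "{X \<in> components (del_verts G S). odd (card X)} = {C, C'}"
  proof (intro equalityI subsetI)
    fix X assume X: "X \<in> {X \<in> components (del_verts G S). odd (card X)}"
    have "T X \<subseteq> S" by (auto simp: T_def)
    show "X \<in> {C, C'}"
    proof (rule ccontr)
      assume "X \<notin> {C, C'}"
      then have "T X = {}"
        using T_disj[of X C] T_disj[of X C'] X C C'(1) st TC' \<open>T X \<subseteq> S\<close> by auto
      then show False using parity[of X] X by simp
    qed
  qed (use C C'(1) parity[OF C'(1)] TC' odd in auto)
  then have "barrier G S"
    using pm S ne unfolding barrier_def by auto
  with nb show False ..
qed

theorem theorem29:
  fixes G :: "('v, 'e) mgraph" and S :: "'v set" and J :: "('w, 'f) mgraph"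
  assumes "matching_covered G"
    and "two_separation G S"
    and "three_connected_cubic J"
    and "is_theta J \<Longrightarrow> card (components (del_verts G S)) = 2"
  shows "free_of J G \<longleftrightarrow>
    (\<forall>L\<in>components (del_verts G S). free_of J (marked_component G S L))"
proof -
  have G: "multigraph G" using assms(1) unfolding matching_covered_def by blast
  have S: "S \<subseteq> verts G" "card S = 2" and disc: "\<not> connected_graph (del_verts G S)"
    using assms(2) unfolding two_separation_def by auto
  have J: "multigraph J" using assms(3) unfolding three_connected_cubic_def by blast
  define K where "K = marked_component G S (verts G - S)"
  define D where "D = del_verts G S"
  have verts_D: "verts D = verts G - S" by (simp add: D_def del_verts_def induced_def)
  note Some_iff = matching_on_Some[OF G S, folded K_def]
  note simps = marked_simps[OF G S, folded K_def]
  note based_G = based_iff_unmarked_embedding[OF G S J, folded K_def]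
  have comp: "attached G S C" "C \<subseteq> verts G" "even (card C)" "C \<noteq> {}" "verts G - S - C \<noteq> {}"
    "separated K None S C (verts G - S - C)" if "C \<in> components D" for C
    using component_attached[OF G that[unfolded D_def]] component_nonempty[OF that]
      component_even[OF assms(1,2) that[unfolded D_def]]
      component_proper[OF disc that[unfolded D_def], folded D_def]
      separated_marked[OF G S] verts_D
    by (auto simp: attached_def K_def)
  \<comment> \<open>The whole graph, \<open>S\<close> and \<open>C\<close> are all even.\<close>
  have even_R: "even (card (verts G - S - C))" if C: "C \<in> components D" for C
  proof -
    have "even (card (verts G))"
      using matching_covered_perfect_matching[OF assms(1)] matching_on_even[OF G]
        perfect_matching_iff_matching_on[OF G] by metis
    moreover have fin: "finite (verts G)" using G unfolding multigraph_def by blast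
    have "card (verts G - S - C) = card (verts G) - card S - card C"
    proof -
      have "C \<subseteq> verts G - S" using comp(1)[OF C] unfolding attached_def by blast
      moreover have "finite S" "finite C"
        using S(1) comp(2)[OF C] fin finite_subset by blast+
      ultimately show ?thesis using S(1) by (simp add: card_Diff_subset)
    qed
    ultimately show ?thesis using S(2) comp(3)[OF C] by simp
  qed
  note based_L = based_marked_component_iff[OF G S J comp(2), folded K_def]
  have "based J G" if L: "L \<in> components D" and b: "based J (marked_component G S L)" for L
  proof -
    \<comment> \<open>The union of all other components, through which the marker edge of
      \<open>L\<close> is expanded.\<close>
    define R where "R = verts G - S - L"
    interpret separated K None S L R using comp(6)[OF L] by (simp add: R_def)
    have attR: "attached G S R" using attached_complement[OF G comp(1)[OF L]] by (simp add: R_def)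
    obtain f p q N where em: "embedding K J f p q" "support J f p \<subseteq> L \<union> S"
      "matching_on K (L \<union> S - support J f p) N"
      using b unfolding based_L[OF L] by blast
    have R_L: "R \<inter> L = {}" using disj by blast
    \<comment> \<open>Here \<open>S\<close> is matched into \<open>R\<close>, in the next step into
      \<open>L\<close>; this gives \<open>M1\<close> on \<open>R\<close> with \<open>S\<close> and
      \<open>M2\<close> on \<open>R\<close> alone.\<close>
    obtain M1 M1' where M1: "matching_on G (R \<union> S) M1" "\<forall>e\<in>M1. ends G e \<noteq> S"
      "matching_on G L M1'"
      using side_matchings[OF assms(1) S attR comp(5)[OF L, folded R_def]
          even_R[OF L, folded R_def] comp(1)[OF L] R_L] .
    obtain M2' M2 where M2: "matching_on G (L \<union> S) M2'" "\<forall>e\<in>M2'. ends G e \<noteq> S"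
      "matching_on G R M2"
      using side_matchings[OF assms(1) S comp(1,4,3)[OF L] attR disj(3)] .
    have "ends K e \<noteq> S" if "e \<in> Some ` M1" for e
    proof -
      obtain d where "d \<in> M1" "e = Some d" using \<open>e \<in> Some ` M1\<close> by blast
      then show ?thesis using M1(2) by (simp add: simps)
    qed
    then show ?thesis
      using embedding_expand_marker[OF J em, of "Some ` M1" "Some ` M2"] M1(1) M2(3)
      unfolding based_G Some_iff by blast
  qed
  moreover have "\<exists>L\<in>components D. based J (marked_component G S L)" if b: "based J G"
  proof -
    obtain f p q N where em: "embedding K J f p q" and unmarked: "\<forall>e\<in>edges J. None \<notin> set (q e)"
      and N: "matching_on K (verts K - support J f p) N"
      using b unfolding based_G by blast
    have finite_S: "finite S" using S(2) card.infinite by fastforce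
    have "3 < card (verts J) \<or> card (verts J) = 2"
      using assms(3) unfolding three_connected_cubic_def k_connected_def is_theta_def by blast
    then have card_J: "card (f ` verts J) = card (verts J)" "2 \<le> card (verts J)"
      using card_image[OF embeddingD(1)[OF em]] by linarith+
    show ?thesis
    proof (cases "f ` verts J = S")
      case False
      \<comment> \<open>There are at least two branch vertices, so their set could lie inside
        \<open>S\<close> only by being equal to it. A branch vertex outside \<open>S\<close> then
        determines the component \<open>C\<close>.\<close>
      have "\<not> f ` verts J \<subseteq> S"
        using False card_seteq[of S "f ` verts J"] card_J S(2) finite_S by auto
      then obtain x where x: "x \<in> verts J" "f x \<notin> S" by blast
      then have "f x \<in> \<Union> (components D)"
        unfolding Union_components verts_D using embeddingD(2)[OF em] simps(1) by auto
      then obtain C where C: "C \<in> components D" "f x \<in> C" by blast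
      interpret separated K None S C "verts G - S - C" using comp(6)[OF C(1)] .
      have f_C: "f ` verts J \<subseteq> C \<union> S"
        using branch_vertices_one_side[OF assms(3) em] x C(2) by blast
      have "\<exists>p q N. embedding K J f p q \<and> support J f p \<subseteq> C \<union> S \<and>
          matching_on K (C \<union> S - support J f p) N"
        by (rule embedding_contract_to_marker[OF J em _ N f_C _ even_R[OF C(1)]])
          (use unmarked unique_detour[OF assms(3) em f_C False] in blast)+
      then show ?thesis using C(1) based_L[OF C(1)] by blast
    next
      case True
      \<comment> \<open>With two vertices \<open>J\<close> must be \<theta>, and the assumption on
        the number of components makes the two sides components \<open>A\<close> and
        \<open>B\<close>.\<close>
      then have "card (verts J) = 2" using card_J(1) S(2) by simp
      then have theta: "is_theta J"
        using assms(3) unfolding three_connected_cubic_def k_connected_def by auto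
      then obtain A B where AB: "components D = {A, B}" "A \<noteq> B"
        using assms(4) unfolding D_def by (auto simp: card_2_iff)
      then have A: "A \<in> components D" and B: "B \<in> components D" by auto
      have "B = verts G - S - A"
        using Union_components[of D] component_disjoint[OF A B AB(2)] AB(1) verts_D by auto
      then interpret separated K None S A B using comp(6)[OF A] by simp
      interpret swapped: separated K None S B A by (rule swap)
      have f_AB: "f ` verts J \<subseteq> A \<union> S" "f ` verts J \<subseteq> B \<union> S" using True by auto
      \<comment> \<open>The side met by at most one path is contracted to the marker edge, so the
        other component is the one whose marked graph is based.\<close>
      from theta_detours[OF theta J em True] show ?thesis
      proof
        assume "\<forall>e\<in>edges J. \<forall>e'\<in>edges J. set (p e) \<inter> B \<noteq> {} \<longrightarrow> set (p e') \<inter> B \<noteq> {} \<longrightarrow> e = e'"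
        then have "\<exists>p q N. embedding K J f p q \<and> support J f p \<subseteq> A \<union> S \<and>
            matching_on K (A \<union> S - support J f p) N"
          by (intro embedding_contract_to_marker[OF J em _ N f_AB(1) _ comp(3)[OF B]])
            (use unmarked in blast)+
        then show ?thesis using A based_L[OF A] by blast
      next
        assume "\<forall>e\<in>edges J. \<forall>e'\<in>edges J. set (p e) \<inter> A \<noteq> {} \<longrightarrow> set (p e') \<inter> A \<noteq> {} \<longrightarrow> e = e'"
        then have "\<exists>p q N. embedding K J f p q \<and> support J f p \<subseteq> B \<union> S \<and>
            matching_on K (B \<union> S - support J f p) N"
          by (intro swapped.embedding_contract_to_marker[OF J em _ N f_AB(2) _ comp(3)[OF A]])
            (use unmarked in blast)+
        then show ?thesis using B based_L[OF B] by blast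
      qed
    qed
  qed
  ultimately show ?thesis unfolding free_of_def D_def by blast
qed

end
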